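(* Let $q$ be a prime power, $C,R$ constants with $C>0$, $\Box\in\{\otimes,\odot,\wedge\}$, and for $n$ with $m=Cn+R$ a positive integer let $V\cong\mathbb{F}_q^n$ and $K=q^{m^2}/|\mathrm{GL}(m,q)|$. Then there exist constants $c>0$ and $n_0$ such that for all such $n\ge n_0$, $$g(V\Box V,m)\le K\cdot\left(1+q^{-cn^2}\right)\cdot\frac{|\mathrm{Gr}(V\Box V,m)|}{|\mathrm{PGL}(V)|}.$$
   Context: $V\otimes V$, $V\odot V$, $V\wedge V$ denote the tensor, symmetric and exterior square, on which $\mathrm{GL}(V)$ acts by $P(v_1\Box v_2)=Pv_1\Box Pv_2$. $\mathrm{Gr}(V\Box V,m)$ is the set of $m$-dimensional subspaces of $V\Box V$, with the induced $\mathrm{GL}(V)$-action, and $g(V\Box V,m)$ is the number of orbits of this action. $\mathrm{PGL}(V)=\mathrm{GL}(V)/\mathbb{F}_q^\times$. *)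

theory Defs
  imports Complex_Main "HOL-Library.Function_Algebras" "HOL-Library.FuncSet"
    "HOL-Library.Cardinality" "HOL-Algebra.Coset" "HOL-Algebra.Group_Action"
    "Jordan_Normal_Form.Matrix"
begin

section \<open>Linear groups\<close>

text \<open>The \<open>n\<close>-dimensional space \<open>V\<close> is represented by \<open>carrier_vec n\<close>.\<close>

definition GL :: "'a::field itself \<Rightarrow> nat \<Rightarrow> 'a mat monoid" where
  "GL ty n = units_of (ring_mat ty n ())"

definition scalar_mats :: "'a::field itself \<Rightarrow> nat \<Rightarrow> 'a mat set" where
  "scalar_mats ty n = {c \<cdot>\<^sub>m 1\<^sub>m n | c. c \<noteq> 0}"

definition PGL :: "'a::field itself \<Rightarrow> nat \<Rightarrow> 'a mat set monoid" where
  "PGL ty n = GL ty n Mod scalar_mats ty n"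


section \<open>Tensor, symmetric and exterior square\<close>

definition fscale :: "'a::field \<Rightarrow> ('b \<Rightarrow> 'a) \<Rightarrow> 'b \<Rightarrow> 'a" where
  "fscale c f = (\<lambda>x. c * f x)"

global_interpretation fvs: vector_space fscale
  by unfold_locales (auto simp: fscale_def fun_eq_iff algebra_simps)

datatype square = Tensor | Symmetric | Exterior

text \<open>
  The square of \<open>V\<close> is modelled by coordinates with respect to the basis of the products of
  \<open>e\<^sub>i\<close> and \<open>e\<^sub>j\<close>, where \<open>(i, j)\<close> ranges over all pairs, the pairs with \<open>i \<le> j\<close>, and the pairs
  with \<open>i < j\<close>, respectively. In every characteristic (2 included) this is the quotient of the
  tensor square by the span of all \<open>v \<otimes> w - w \<otimes> v\<close>, respectively of all \<open>v \<otimes> v\<close>; see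
  \<open>sq_universal\<close> below.
\<close>

fun sq_index :: "square \<Rightarrow> nat \<Rightarrow> (nat \<times> nat) set" where
  "sq_index Tensor n = {(i, j). i < n \<and> j < n}"
| "sq_index Symmetric n = {(i, j). i \<le> j \<and> j < n}"
| "sq_index Exterior n = {(i, j). i < j \<and> j < n}"

definition sq_space :: "square \<Rightarrow> nat \<Rightarrow> (nat \<times> nat \<Rightarrow> 'a::field) set" where
  "sq_space b n = {x. \<forall>p. p \<notin> sq_index b n \<longrightarrow> x p = 0}"

fun sq_coeff :: "square \<Rightarrow> 'a::field vec \<Rightarrow> 'a vec \<Rightarrow> nat \<times> nat \<Rightarrow> 'a" where
  "sq_coeff Tensor v w (i, j) = v $ i * w $ j"
| "sq_coeff Symmetric v w (i, j) =
    (if i = j then v $ i * w $ i else v $ i * w $ j + v $ j * w $ i)"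
| "sq_coeff Exterior v w (i, j) = v $ i * w $ j - v $ j * w $ i"

definition sq_prod :: "square \<Rightarrow> nat \<Rightarrow> 'a::field vec \<Rightarrow> 'a vec \<Rightarrow> nat \<times> nat \<Rightarrow> 'a" where
  "sq_prod b n v w = (\<lambda>p. if p \<in> sq_index b n then sq_coeff b v w p else 0)"

text \<open>
  The linear extension of \<open>e\<^sub>i \<box> e\<^sub>j \<mapsto> P e\<^sub>i \<box> P e\<^sub>j\<close>; by \<open>sq_act_unique\<close> below it is the unique
  linear map on the square with \<open>v \<box> w \<mapsto> P v \<box> P w\<close> for all \<open>v\<close> and \<open>w\<close>.
\<close>

definition sq_act ::
  "square \<Rightarrow> nat \<Rightarrow> 'a::field mat \<Rightarrow> (nat \<times> nat \<Rightarrow> 'a) \<Rightarrow> nat \<times> nat \<Rightarrow> 'a" where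
  "sq_act b n P x = (\<Sum>(i, j)\<in>sq_index b n.
     fscale (x (i, j)) (sq_prod b n (P *\<^sub>v unit_vec n i) (P *\<^sub>v unit_vec n j)))"

definition Gr :: "square \<Rightarrow> nat \<Rightarrow> nat \<Rightarrow> (nat \<times> nat \<Rightarrow> 'a::field) set set" where
  "Gr b n m = {U. fvs.subspace U \<and> U \<subseteq> sq_space b n \<and> fvs.dim U = m}"

definition Gr_act :: "square \<Rightarrow> nat \<Rightarrow> nat \<Rightarrow> 'a::field mat \<Rightarrow>
    (nat \<times> nat \<Rightarrow> 'a) set \<Rightarrow> (nat \<times> nat \<Rightarrow> 'a) set" where
  "Gr_act b n m P = (\<lambda>U\<in>Gr b n m. sq_act b n P ` U)"

definition num_orbits :: "'a::field itself \<Rightarrow> square \<Rightarrow> nat \<Rightarrow> nat \<Rightarrow> nat" where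
  "num_orbits ty b n m = card (orbits (GL ty n) (Gr b n m) (Gr_act b n m))"


section \<open>Adequacy of the coordinate model\<close>

definition bilin :: "nat \<Rightarrow> ('a::field \<Rightarrow> 'e \<Rightarrow> 'e) \<Rightarrow> ('a vec \<Rightarrow> 'a vec \<Rightarrow> 'e::ab_group_add) \<Rightarrow> bool"
  where "bilin n s B \<longleftrightarrow>
    (\<forall>u\<in>carrier_vec n. \<forall>v\<in>carrier_vec n. \<forall>w\<in>carrier_vec n. \<forall>c.
       B (u + v) w = B u w + B v w \<and> B w (u + v) = B w u + B w v \<and>
       B (c \<cdot>\<^sub>v u) w = s c (B u w) \<and> B w (c \<cdot>\<^sub>v u) = s c (B w u))"

fun sq_kind :: "square \<Rightarrow> nat \<Rightarrow> ('a::field vec \<Rightarrow> 'a vec \<Rightarrow> 'e::ab_group_add) \<Rightarrow> bool" where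
  "sq_kind Tensor n B \<longleftrightarrow> True"
| "sq_kind Symmetric n B \<longleftrightarrow> (\<forall>v\<in>carrier_vec n. \<forall>w\<in>carrier_vec n. B v w = B w v)"
| "sq_kind Exterior n B \<longleftrightarrow> (\<forall>v\<in>carrier_vec n. B v v = 0)"

definition lin_sq :: "square \<Rightarrow> nat \<Rightarrow> ('a::field \<Rightarrow> 'e \<Rightarrow> 'e) \<Rightarrow>
    ((nat \<times> nat \<Rightarrow> 'a) \<Rightarrow> 'e::ab_group_add) \<Rightarrow> bool" where
  "lin_sq b n s f \<longleftrightarrow> (\<forall>x\<in>sq_space b n. \<forall>y\<in>sq_space b n. \<forall>c.
     f (x + y) = f x + f y \<and> f (fscale c x) = s c (f x))"

lemma sq_index_subset: "sq_index b n \<subseteq> {..<n} \<times> {..<n}"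
  by (cases b) auto

lemma finite_sq_index: "finite (sq_index b n)"
  by (rule finite_subset[OF sq_index_subset]) auto

lemma fscale_apply: "fscale c f p = c * f p"
  by (simp add: fscale_def)

lemma sq_prod_in: "sq_prod b n v w \<in> sq_space b n"
  by (auto simp: sq_prod_def sq_space_def)

lemma subspace_sq_space: "fvs.subspace (sq_space b n)"
  by (rule fvs.subspaceI) (auto simp: sq_space_def fscale_def)

lemma sq_prod_bilin: "bilin n fscale (sq_prod b n)"
  unfolding bilin_def
proof (intro ballI allI conjI ext)
  fix u v w :: "'a vec" and c :: 'a and p :: "nat \<times> nat"
  assume uvw: "u \<in> carrier_vec n" "v \<in> carrier_vec n" "w \<in> carrier_vec n"
  obtain i j where p: "p = (i, j)" by force
  have ij: "i < n \<and> j < n" if "(i, j) \<in> sq_index b n"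
    using that sq_index_subset[of b n] by auto
  note s = p sq_prod_def fscale_def algebra_simps
  show "sq_prod b n (u + v) w p = (sq_prod b n u w + sq_prod b n v w) p"
    using uvw ij by (cases b) (auto simp: s)
  show "sq_prod b n w (u + v) p = (sq_prod b n w u + sq_prod b n w v) p"
    using uvw ij by (cases b) (auto simp: s)
  show "sq_prod b n (c \<cdot>\<^sub>v u) w p = fscale c (sq_prod b n u w) p"
    using uvw ij by (cases b) (auto simp: s)
  show "sq_prod b n w (c \<cdot>\<^sub>v u) p = fscale c (sq_prod b n w u) p"
    using uvw ij by (cases b) (auto simp: s)
qed

lemma sq_prod_kind: "sq_kind b n (sq_prod b n :: 'a::field vec \<Rightarrow> 'a vec \<Rightarrow> nat \<times> nat \<Rightarrow> 'a)"
  by (cases b) (auto simp: sq_prod_def fun_eq_iff algebra_simps)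

lemma linear_expand:
  fixes g :: "'a::field vec \<Rightarrow> 'e::ab_group_add"
  assumes "vector_space s"
    and add: "\<And>u v. u \<in> carrier_vec n \<Longrightarrow> v \<in> carrier_vec n \<Longrightarrow> g (u + v) = g u + g v"
    and sc: "\<And>u c. u \<in> carrier_vec n \<Longrightarrow> g (c \<cdot>\<^sub>v u) = s c (g u)"
    and v: "v \<in> carrier_vec n"
  shows "g v = (\<Sum>i<n. s (v $ i) (g (unit_vec n i)))"
proof -
  interpret vector_space s by fact
  have "k \<le> n \<Longrightarrow> g (vec n (\<lambda>i. if i < k then v $ i else 0)) = (\<Sum>i<k. s (v $ i) (g (unit_vec n i)))"
    for k
  proof (induction k)
    case 0
    have e: "0 \<cdot>\<^sub>v unit_vec n 0 = vec n (\<lambda>i. if i < 0 then v $ i else 0)"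
      by (auto simp: unit_vec_def)
    show ?case using sc[of "unit_vec n 0" 0] unfolding e by simp
  next
    case (Suc k)
    have e: "vec n (\<lambda>i. if i < Suc k then v $ i else 0)
        = vec n (\<lambda>i. if i < k then v $ i else 0) + v $ k \<cdot>\<^sub>v unit_vec n k"
      using Suc.prems by (intro eq_vecI) (auto simp: unit_vec_def less_Suc_eq)
    show ?case unfolding e using Suc by (subst add) (auto simp: sc)
  qed
  from this[of n] have "g (vec n (\<lambda>i. if i < n then v $ i else 0))
      = (\<Sum>i<n. s (v $ i) (g (unit_vec n i)))" by simp
  moreover have "vec n (\<lambda>i. if i < n then v $ i else 0) = v" using v by auto
  ultimately show ?thesis by simp
qed

lemma bilin_expand:
  fixes B :: "'a::field vec \<Rightarrow> 'a vec \<Rightarrow> 'e::ab_group_add"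
  assumes vs: "vector_space s" and B: "bilin n s B"
    and v: "v \<in> carrier_vec n" and w: "w \<in> carrier_vec n"
  shows "B v w = (\<Sum>i<n. \<Sum>j<n. s (v $ i * w $ j) (B (unit_vec n i) (unit_vec n j)))"
proof -
  interpret vector_space s by fact
  have "B v w = (\<Sum>i<n. s (v $ i) (B (unit_vec n i) w))"
    using B w by (intro linear_expand[OF vs, of n "\<lambda>v. B v w"] v) (auto simp: bilin_def)
  also have "\<dots> = (\<Sum>i<n. s (v $ i) (\<Sum>j<n. s (w $ j) (B (unit_vec n i) (unit_vec n j))))"
    using B by (intro sum.cong refl arg_cong[of _ _ "s _"] linear_expand[OF vs, of n "B _"] w)
      (auto simp: bilin_def)
  finally show ?thesis by (simp add: scale_sum_right)
qed

lemma sum_square_split: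
  fixes h :: "nat \<Rightarrow> nat \<Rightarrow> 'e::ab_group_add"
  shows "(\<Sum>i<n. \<Sum>j<n. h i j) = (\<Sum>i<n. h i i) + (\<Sum>(i, j)\<in>sq_index Exterior n. h i j + h j i)"
proof -
  let ?S = "{..<n} \<times> {..<n}"
  let ?D = "{(i, j). i = j \<and> j < n}" and ?U = "{(i, j). i < j \<and> j < n}"
    and ?L = "{(i, j). j < i \<and> i < n}"
  have fin: "finite ?D" "finite ?U" "finite ?L"
    by (auto intro: finite_subset[of _ ?S])
  have S: "?S = ?D \<union> (?U \<union> ?L)" by auto
  have "(\<Sum>i<n. \<Sum>j<n. h i j) = (\<Sum>(i, j)\<in>?S. h i j)" by (simp add: sum.cartesian_product)
  also have "\<dots> = (\<Sum>(i, j)\<in>?D. h i j) + ((\<Sum>(i, j)\<in>?U. h i j) + (\<Sum>(i, j)\<in>?L. h i j))"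
    unfolding S using fin by (subst sum.union_disjoint, auto)+
  also have "(\<Sum>(i, j)\<in>?D. h i j) = (\<Sum>i<n. h i i)"
    by (rule sum.reindex_bij_witness[of _ "\<lambda>i. (i, i)" fst]) auto
  also have "(\<Sum>(i, j)\<in>?L. h i j) = (\<Sum>(i, j)\<in>?U. h j i)"
    by (rule sum.reindex_bij_witness[of _ prod.swap prod.swap]) auto
  finally show ?thesis by (simp add: sum.distrib case_prod_unfold)
qed

lemma kind_expand:
  fixes B :: "'a::field vec \<Rightarrow> 'a vec \<Rightarrow> 'e::ab_group_add"
  assumes vs: "vector_space s" and B: "bilin n s B" and K: "sq_kind b n B"
    and v: "v \<in> carrier_vec n" and w: "w \<in> carrier_vec n"
  shows "(\<Sum>(i, j)\<in>sq_index b n. s (sq_prod b n v w (i, j)) (B (unit_vec n i) (unit_vec n j))) = B v w"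
proof -
  interpret vector_space s by fact
  let ?e = "\<lambda>i. unit_vec n i :: 'a vec"
  note X = bilin_expand[OF vs B v w]
  show ?thesis
  proof (cases b)
    case Tensor
    have "(\<Sum>(i, j)\<in>sq_index b n. s (sq_prod b n v w (i, j)) (B (?e i) (?e j)))
       = (\<Sum>(i, j)\<in>{..<n} \<times> {..<n}. s (v $ i * w $ j) (B (?e i) (?e j)))"
      by (rule sum.cong) (auto simp: sq_prod_def Tensor)
    then show ?thesis unfolding X by (simp only: sum.cartesian_product)
  next
    case Symmetric
    let ?D = "{(i, j). i = j \<and> j < n}" and ?U = "sq_index Exterior n"
    have sym: "B (?e i) (?e j) = B (?e j) (?e i)" for i j
      using K Symmetric by auto
    have fin: "finite ?D" by (auto intro: finite_subset[of _ "{..<n} \<times> {..<n}"])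
    have I: "sq_index b n = ?D \<union> ?U" using Symmetric by auto
    have "(\<Sum>(i, j)\<in>sq_index b n. s (sq_prod b n v w (i, j)) (B (?e i) (?e j)))
       = (\<Sum>(i, j)\<in>?D. s (sq_prod b n v w (i, j)) (B (?e i) (?e j)))
       + (\<Sum>(i, j)\<in>?U. s (sq_prod b n v w (i, j)) (B (?e i) (?e j)))"
      unfolding I using fin finite_sq_index[of Exterior n] by (intro sum.union_disjoint) auto
    also have "(\<Sum>(i, j)\<in>?D. s (sq_prod b n v w (i, j)) (B (?e i) (?e j)))
       = (\<Sum>i<n. s (v $ i * w $ i) (B (?e i) (?e i)))"
      by (rule sum.reindex_bij_witness[of _ "\<lambda>i. (i, i)" fst])
        (auto simp: sq_prod_def Symmetric)
    also have "(\<Sum>(i, j)\<in>?U. s (sq_prod b n v w (i, j)) (B (?e i) (?e j)))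
       = (\<Sum>(i, j)\<in>?U. s (v $ i * w $ j) (B (?e i) (?e j)) + s (v $ j * w $ i) (B (?e j) (?e i)))"
      by (rule sum.cong) (auto simp: sq_prod_def Symmetric sym scale_left_distrib)
    finally show ?thesis unfolding X sum_square_split .
  next
    case Exterior
    have alt: "B u u = 0" if "u \<in> carrier_vec n" for u
      using K Exterior that by auto
    have anti: "B (?e j) (?e i) = - B (?e i) (?e j)" for i j
    proof -
      have "0 = B (?e i + ?e j) (?e i + ?e j)" by (simp add: alt)
      also have "\<dots> = B (?e i) (?e i + ?e j) + B (?e j) (?e i + ?e j)"
        using B unfolding bilin_def by (meson unit_vec_carrier add_carrier_vec)
      also have "\<dots> = (B (?e i) (?e i) + B (?e i) (?e j)) + (B (?e j) (?e i) + B (?e j) (?e j))"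
        using B unfolding bilin_def by (metis unit_vec_carrier)
      finally show ?thesis by (simp add: alt eq_neg_iff_add_eq_0 add.commute)
    qed
    have eq: "s (sq_prod b n v w (i, j)) (B (?e i) (?e j))
       = s (v $ i * w $ j) (B (?e i) (?e j)) + s (v $ j * w $ i) (B (?e j) (?e i))"
      if "(i, j) \<in> sq_index Exterior n" for i j
      unfolding anti[of i j] using that
      by (simp add: sq_prod_def Exterior scale_left_diff_distrib)
    have "(\<Sum>(i, j)\<in>sq_index b n. s (sq_prod b n v w (i, j)) (B (?e i) (?e j)))
       = (\<Sum>(i, j)\<in>sq_index Exterior n.
            s (v $ i * w $ j) (B (?e i) (?e j)) + s (v $ j * w $ i) (B (?e j) (?e i)))"
      unfolding Exterior by (intro sum.cong refl) (use eq Exterior in \<open>auto simp del: sq_index.simps\<close>)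
    then show ?thesis unfolding X sum_square_split by (simp add: alt)
  qed
qed

lemma sq_prod_unit:
  "(i, j) \<in> sq_index b n \<Longrightarrow>
   sq_prod b n (unit_vec n i) (unit_vec n j) = (\<lambda>p. if p = (i, j) then 1 else (0::'a::field))"
  by (cases b) (auto simp: sq_prod_def unit_vec_def fun_eq_iff)

lemma sum_fun_apply: "(\<Sum>a\<in>A. F a) p = (\<Sum>a\<in>A. F a p)"
  by (induction A rule: infinite_finite_induct) auto

lemma sq_expand:
  assumes "x \<in> sq_space b n"
  shows "x = (\<Sum>(i, j)\<in>sq_index b n. fscale (x (i, j)) (sq_prod b n (unit_vec n i) (unit_vec n j)))"
    (is "x = ?r")
proof
  fix p
  have "?r p = (\<Sum>a\<in>sq_index b n. if a = p then x a else 0)"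
    unfolding sum_fun_apply
    by (intro sum.cong refl) (auto simp: sq_prod_unit fscale_def)
  also have "\<dots> = x p"
    using assms finite_sq_index[of b n] by (simp add: sq_space_def del: split_paired_All)
  finally show "x p = ?r p" by simp
qed

lemma lin_sq_expand:
  assumes vs: "vector_space s" and f: "lin_sq b n s f" and x: "x \<in> sq_space b n"
  shows "f x = (\<Sum>(i, j)\<in>sq_index b n. s (x (i, j)) (f (sq_prod b n (unit_vec n i) (unit_vec n j))))"
proof -
  interpret vector_space s by fact
  have z: "(0 :: nat \<times> nat \<Rightarrow> _) \<in> sq_space b n" by (simp add: sq_space_def)
  have f0: "f 0 = 0" using f z unfolding lin_sq_def
    by (metis add_cancel_right_left add.right_neutral)
  have sp: "fvs.subspace (sq_space b n)" by (rule subspace_sq_space)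
  have "finite A \<Longrightarrow>
    (\<Sum>(i, j)\<in>A. fscale (x (i, j)) (sq_prod b n (unit_vec n i) (unit_vec n j))) \<in> sq_space b n \<and>
    f (\<Sum>(i, j)\<in>A. fscale (x (i, j)) (sq_prod b n (unit_vec n i) (unit_vec n j)))
    = (\<Sum>(i, j)\<in>A. s (x (i, j)) (f (sq_prod b n (unit_vec n i) (unit_vec n j))))" for A
  proof (induction A rule: finite_induct)
    case empty then show ?case using f0 z by (simp add: zero_fun_def)
  next
    case (insert a A)
    obtain i j where a: "a = (i, j)" by force
    let ?t = "fscale (x (i, j)) (sq_prod b n (unit_vec n i) (unit_vec n j))"
    have t: "?t \<in> sq_space b n" by (rule fvs.subspace_scale[OF sp sq_prod_in])
    let ?r = "\<Sum>(i, j)\<in>A. fscale (x (i, j)) (sq_prod b n (unit_vec n i) (unit_vec n j))"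
    have r: "?r \<in> sq_space b n" using insert by blast
    have e: "(\<Sum>(i, j)\<in>insert a A. fscale (x (i, j)) (sq_prod b n (unit_vec n i) (unit_vec n j)))
        = ?t + ?r"
      using insert.hyps by (subst sum.insert) (auto simp: a)
    have "f (?t + ?r) = f ?t + f ?r"
      using f t r unfolding lin_sq_def by blast
    also have "f ?t = s (x (i, j)) (f (sq_prod b n (unit_vec n i) (unit_vec n j)))"
      using f sq_prod_in unfolding lin_sq_def by blast
    also have "f ?r = (\<Sum>(i, j)\<in>A. s (x (i, j)) (f (sq_prod b n (unit_vec n i) (unit_vec n j))))"
      using insert.IH by blast
    also have "s (x (i, j)) (f (sq_prod b n (unit_vec n i) (unit_vec n j))) + \<dots>
        = (\<Sum>(i, j)\<in>insert a A. s (x (i, j)) (f (sq_prod b n (unit_vec n i) (unit_vec n j))))"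
      using insert.hyps by (simp add: a)
    finally have "f (?t + ?r)
        = (\<Sum>(i, j)\<in>insert a A. s (x (i, j)) (f (sq_prod b n (unit_vec n i) (unit_vec n j))))" .
    then show ?case unfolding e using fvs.subspace_add[OF sp t r] by blast
  qed
  note * = conjunct2[OF this[OF finite_sq_index[of b n]]]
  show ?thesis by (rule trans[OF arg_cong[OF sq_expand[OF x], of f] *])
qed

lemma sq_space_span:
  "sq_space b n = fvs.span {sq_prod b n v w | v w. v \<in> carrier_vec n \<and> w \<in> carrier_vec n}"
    (is "_ = fvs.span ?P")
proof
  show "fvs.span ?P \<subseteq> sq_space b n"
    by (rule fvs.span_minimal) (auto simp: sq_prod_in subspace_sq_space)
  show "sq_space b n \<subseteq> fvs.span ?P"
  proof
    fix x :: "nat \<times> nat \<Rightarrow> 'a" assume "x \<in> sq_space b n"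
    from sq_expand[OF this] show "x \<in> fvs.span ?P"
      by (metis (mono_tags, lifting) CollectI case_prod_unfold fvs.span_base fvs.span_scale
          fvs.span_sum unit_vec_carrier)
  qed
qed

theorem sq_universal:
  fixes B :: "'a::field vec \<Rightarrow> 'a vec \<Rightarrow> 'e::ab_group_add"
  assumes vs: "vector_space s" and B: "bilin n s B" and K: "sq_kind b n B"
  shows "\<exists>!f. f \<in> extensional (sq_space b n) \<and> lin_sq b n s f \<and>
    (\<forall>v\<in>carrier_vec n. \<forall>w\<in>carrier_vec n. f (sq_prod b n v w) = B v w)"
proof -
  interpret vector_space s by fact
  let ?f = "\<lambda>x\<in>sq_space b n. \<Sum>(i, j)\<in>sq_index b n. s (x (i, j)) (B (unit_vec n i) (unit_vec n j))"
  have sp: "fvs.subspace (sq_space b n :: (nat \<times> nat \<Rightarrow> 'a) set)" by (rule subspace_sq_space)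
  have lin: "lin_sq b n s ?f"
    unfolding lin_sq_def
  proof (intro ballI allI conjI)
    fix x y :: "nat \<times> nat \<Rightarrow> 'a" and c
    assume x: "x \<in> sq_space b n" and y: "y \<in> sq_space b n"
    note xy = fvs.subspace_add[OF sp x y] and cx = fvs.subspace_scale[OF sp x, of c]
    show "?f (x + y) = ?f x + ?f y"
      unfolding restrict_apply'[OF x] restrict_apply'[OF y] restrict_apply'[OF xy]
      by (simp add: case_prod_unfold scale_left_distrib sum.distrib)
    show "?f (fscale c x) = s c (?f x)"
      unfolding restrict_apply'[OF x] restrict_apply'[OF cx]
      by (simp add: fscale_apply case_prod_unfold scale_sum_right)
  qed
  show ?thesis
  proof (rule ex1I[of _ ?f], intro conjI ballI)
    fix f assume f: "f \<in> extensional (sq_space b n) \<and> lin_sq b n s f \<and>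
      (\<forall>v\<in>carrier_vec n. \<forall>w\<in>carrier_vec n. f (sq_prod b n v w) = B v w)"
    show "f = ?f"
    proof (rule extensionalityI[of _ "sq_space b n"])
      fix x :: "nat \<times> nat \<Rightarrow> 'a" assume x: "x \<in> sq_space b n"
      have "f x = (\<Sum>(i, j)\<in>sq_index b n.
          s (x (i, j)) (f (sq_prod b n (unit_vec n i) (unit_vec n j))))"
        using f x by (intro lin_sq_expand[OF vs]) auto
      also have "\<dots> = ?f x" using f x by simp
      finally show "f x = ?f x" .
    qed (use f in simp_all)
  next
    fix v w :: "'a vec" assume "v \<in> carrier_vec n" "w \<in> carrier_vec n"
    then show "?f (sq_prod b n v w) = B v w"
      unfolding restrict_apply'[OF sq_prod_in] by (rule kind_expand[OF vs B K])
  qed (rule restrict_extensional lin)+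
qed

lemma vector_space_fscale: "vector_space fscale"
  by (rule fvs.vector_space_axioms)

lemma sq_act_in: "sq_act b n P x \<in> sq_space b n"
  unfolding sq_act_def case_prod_unfold
  by (intro fvs.subspace_sum fvs.subspace_scale subspace_sq_space sq_prod_in)

lemma sq_act_linear: "lin_sq b n fscale (sq_act b n P)"
  unfolding lin_sq_def sq_act_def
  by (simp add: case_prod_unfold fvs.scale_left_distrib sum.distrib fvs.scale_sum_right fscale_apply)

lemma sq_act_prod:
  assumes P: "P \<in> carrier_mat n n" and v: "v \<in> carrier_vec n" and w: "w \<in> carrier_vec n"
  shows "sq_act b n P (sq_prod b n v w) = sq_prod b n (P *\<^sub>v v) (P *\<^sub>v w)"
proof -
  have B: "bilin n fscale (\<lambda>v w. sq_prod b n (P *\<^sub>v v) (P *\<^sub>v w))"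
    unfolding bilin_def
  proof (intro ballI allI)
    fix u v w :: "'a vec" and c
    assume uvw: "u \<in> carrier_vec n" "v \<in> carrier_vec n" "w \<in> carrier_vec n"
    then have "P *\<^sub>v u \<in> carrier_vec n" "P *\<^sub>v v \<in> carrier_vec n" "P *\<^sub>v w \<in> carrier_vec n"
      using P by auto
    with uvw show "sq_prod b n (P *\<^sub>v (u + v)) (P *\<^sub>v w)
        = sq_prod b n (P *\<^sub>v u) (P *\<^sub>v w) + sq_prod b n (P *\<^sub>v v) (P *\<^sub>v w) \<and>
      sq_prod b n (P *\<^sub>v w) (P *\<^sub>v (u + v))
        = sq_prod b n (P *\<^sub>v w) (P *\<^sub>v u) + sq_prod b n (P *\<^sub>v w) (P *\<^sub>v v) \<and>
      sq_prod b n (P *\<^sub>v (c \<cdot>\<^sub>v u)) (P *\<^sub>v w) = fscale c (sq_prod b n (P *\<^sub>v u) (P *\<^sub>v w)) \<and>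
      sq_prod b n (P *\<^sub>v w) (P *\<^sub>v (c \<cdot>\<^sub>v u)) = fscale c (sq_prod b n (P *\<^sub>v w) (P *\<^sub>v u))"
      using sq_prod_bilin[of n b] unfolding bilin_def
      by (metis mult_add_distrib_mat_vec[OF P] mult_mat_vec[OF P])
  qed
  have K: "sq_kind b n (\<lambda>v w. sq_prod b n (P *\<^sub>v v) (P *\<^sub>v w))"
    using sq_prod_kind[of b n, where 'a = 'a] P by (cases b) auto
  show ?thesis unfolding sq_act_def by (rule kind_expand[OF vector_space_fscale B K v w])
qed

theorem sq_act_unique:
  assumes P: "P \<in> carrier_mat n n" and f: "lin_sq b n fscale f"
    and "\<And>v w. v \<in> carrier_vec n \<Longrightarrow> w \<in> carrier_vec n \<Longrightarrow>
      f (sq_prod b n v w) = sq_prod b n (P *\<^sub>v v) (P *\<^sub>v w)"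
    and x: "x \<in> sq_space b n"
  shows "f x = sq_act b n P x"
  unfolding lin_sq_expand[OF vector_space_fscale f x] sq_act_def by (simp add: assms(3))

lemma sq_act_mult:
  assumes P: "P \<in> carrier_mat n n" and Q: "Q \<in> carrier_mat n n" and x: "x \<in> sq_space b n"
  shows "sq_act b n (P * Q) x = sq_act b n P (sq_act b n Q x)"
proof (rule sq_act_unique[symmetric, OF _ _ _ x])
  show "lin_sq b n fscale (\<lambda>x. sq_act b n P (sq_act b n Q x))"
    using sq_act_linear[of b n P] sq_act_linear[of b n Q] by (simp add: lin_sq_def sq_act_in)
qed (use P Q in \<open>auto simp: sq_act_prod assoc_mult_mat_vec[OF P Q]\<close>)

lemma sq_act_one: "x \<in> sq_space b n \<Longrightarrow> sq_act b n (1\<^sub>m n) x = x"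
  by (rule sq_act_unique[of _ _ _ "\<lambda>x. x", symmetric]) (auto simp: lin_sq_def)

lemma group_GL: "group (GL TYPE('a::field) n)"
proof -
  interpret ring "ring_mat TYPE('a) n ()" by (rule ring_mat)
  show ?thesis unfolding GL_def by (rule units_group)
qed

lemma carrier_GL:
  "carrier (GL TYPE('a::field) n) = {P \<in> carrier_mat n n. \<exists>Q\<in>carrier_mat n n. Q * P = 1\<^sub>m n \<and> P * Q = 1\<^sub>m n}"
  by (auto simp: GL_def units_of_def Units_def ring_mat_simps)

lemma mult_GL: "monoid.mult (GL TYPE('a::field) n) = (*)"
  by (simp add: GL_def units_of_def ring_mat_simps)

lemma one_GL: "monoid.one (GL TYPE('a::field) n) = 1\<^sub>m n"
  by (simp add: GL_def units_of_def ring_mat_simps)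

lemma Gr_act_closed:
  fixes P :: "'a::field mat"
  assumes P: "P \<in> carrier (GL TYPE('a) n)" and U: "U \<in> Gr b n m"
  shows "sq_act b n P ` U \<in> Gr b n m"
proof -
  from P obtain Q where PQ: "P \<in> carrier_mat n n" "Q \<in> carrier_mat n n" "Q * P = 1\<^sub>m n"
    by (auto simp: carrier_GL)
  have lin: "Vector_Spaces.linear fscale fscale (sq_act b n P)"
    by unfold_locales
      (simp_all add: sq_act_def case_prod_unfold fvs.scale_left_distrib sum.distrib
        fvs.scale_sum_right fscale_apply)
  interpret L: Vector_Spaces.linear fscale fscale "sq_act b n P" by (rule lin)
  from U have U': "fvs.subspace U" "U \<subseteq> sq_space b n" "fvs.dim U = m" by (auto simp: Gr_def)
  have inj: "inj_on (sq_act b n P) U"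
    by (rule inj_on_inverseI[of _ "sq_act b n Q"])
      (use U' PQ in \<open>auto simp: sq_act_one simp flip: sq_act_mult\<close>)
  interpret vector_space_pair "fscale :: 'a \<Rightarrow> _ \<Rightarrow> nat \<times> nat \<Rightarrow> 'a"
      "fscale :: 'a \<Rightarrow> _ \<Rightarrow> nat \<times> nat \<Rightarrow> 'a" ..
  have sU: "fvs.span U = U" using U'(1) by (simp add: fvs.span_eq_iff)
  obtain X where X: "X \<subseteq> U" "fvs.independent X" "U \<subseteq> fvs.span X" "card X = fvs.dim U"
    using fvs.basis_exists by blast
  have spX: "fvs.span X = U" using X U'(1) fvs.span_minimal by blast
  have ind: "fvs.independent (sq_act b n P ` X)"
    using linear_independent_injective_image[OF lin X(2)] inj spX by simp
  have "fvs.dim (sq_act b n P ` U) = fvs.dim (sq_act b n P ` X)"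
    using linear_span_image[OF lin, of X] spX by (metis fvs.dim_span)
  also have "\<dots> = card (sq_act b n P ` X)" using ind by (rule fvs.dim_eq_card_independent)
  also have "\<dots> = m" using X U' inj by (metis card_image inj_on_subset)
  finally show ?thesis using U' L.subspace_image[OF U'(1)] by (auto simp: Gr_def sq_act_in)
qed

lemma finite_Gr: "finite (Gr b n m :: (nat \<times> nat \<Rightarrow> 'a::{field, finite}) set set)"
proof -
  have "sq_space b n \<subseteq> {x :: nat \<times> nat \<Rightarrow> 'a.
      \<forall>p. (p \<in> sq_index b n \<longrightarrow> x p \<in> UNIV) \<and> (p \<notin> sq_index b n \<longrightarrow> x p = 0)}"
    unfolding sq_space_def by blast
  then have "finite (sq_space b n :: (nat \<times> nat \<Rightarrow> 'a) set)"
    by (rule finite_subset) (rule finite_set_of_finite_funs[OF finite_sq_index finite])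
  then have "finite (Pow (sq_space b n :: (nat \<times> nat \<Rightarrow> 'a) set))" by simp
  then show ?thesis by (rule rev_finite_subset) (auto simp: Gr_def)
qed

theorem group_action_Gr: "group_action (GL TYPE('a::field) n) (Gr b n m) (Gr_act b n m)"
proof -
  interpret G: group "GL TYPE('a) n" by (rule group_GL)
  have sub: "U \<subseteq> sq_space b n" if "U \<in> Gr b n m" for U :: "(nat \<times> nat \<Rightarrow> 'a) set"
    using that by (auto simp: Gr_def)
  have mul: "sq_act b n (P * Q) ` U = sq_act b n P ` sq_act b n Q ` U"
    if "P \<in> carrier_mat n n" "Q \<in> carrier_mat n n" "U \<in> Gr b n m"
    for P Q :: "'a mat" and U
    unfolding image_image
    by (rule image_cong[OF refl sq_act_mult[OF that(1,2)]]) (use sub[OF that(3)] in blast)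
  have bij: "Gr_act b n m P \<in> Bij (Gr b n m)" if P: "P \<in> carrier (GL TYPE('a) n)" for P
  proof -
    from P obtain Q where PQ: "P \<in> carrier_mat n n" "Q \<in> carrier_mat n n"
      "Q * P = 1\<^sub>m n" "P * Q = 1\<^sub>m n" by (auto simp: carrier_GL)
    then have Q: "Q \<in> carrier (GL TYPE('a) n)" by (auto simp: carrier_GL)
    have one: "sq_act b n (1\<^sub>m n) ` U = U" if "U \<in> Gr b n m" for U :: "(nat \<times> nat \<Rightarrow> 'a) set"
      using sub[OF that] by (force simp: sq_act_one)
    have "bij_betw (Gr_act b n m P) (Gr b n m) (Gr b n m)"
      by (rule bij_betwI[of _ _ _ "Gr_act b n m Q"])
        (use P Q PQ in \<open>auto simp: Gr_act_def Gr_act_closed one simp flip: mul\<close>)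
    then show ?thesis by (simp add: Bij_def Gr_act_def)
  qed
  have "Gr_act b n m \<in> hom (GL TYPE('a) n) (BijGroup (Gr b n m))"
  proof (rule homI)
    fix P Q assume P: "P \<in> carrier (GL TYPE('a) n)" and Q: "Q \<in> carrier (GL TYPE('a) n)"
    have "Gr_act b n m (P * Q) = compose (Gr b n m) (Gr_act b n m P) (Gr_act b n m Q)"
      using P Q by (auto simp: Gr_act_def compose_def fun_eq_iff Gr_act_closed mul carrier_GL)
    then show "Gr_act b n m (P \<otimes>\<^bsub>GL TYPE('a) n\<^esub> Q)
        = Gr_act b n m P \<otimes>\<^bsub>BijGroup (Gr b n m)\<^esub> Gr_act b n m Q"
      using bij[OF P] bij[OF Q] by (simp add: mult_GL BijGroup_def)
  qed (use bij in \<open>auto simp: BijGroup_def\<close>)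
  then show ?thesis
    by (simp add: group_action_def group_hom_def group_hom_axioms_def group_BijGroup group_GL)
qed

lemma scalar_mats_normal: "scalar_mats TYPE('a::field) n \<lhd> GL TYPE('a) n"
proof -
  interpret G: group "GL TYPE('a) n" by (rule group_GL)
  let ?S = "scalar_mats TYPE('a) n"
  have m: "(c \<cdot>\<^sub>m 1\<^sub>m n) * A = c \<cdot>\<^sub>m A" "A * (c \<cdot>\<^sub>m 1\<^sub>m n) = c \<cdot>\<^sub>m A"
    if "A \<in> carrier_mat n n" for c and A :: "'a mat"
    using that by (auto simp: mult_smult_assoc_mat[of _ n n _ n] mult_smult_distrib[of _ n n _ n])
  have inv: "(c \<cdot>\<^sub>m 1\<^sub>m n) * (inverse c \<cdot>\<^sub>m 1\<^sub>m n) = (1\<^sub>m n :: 'a mat)" if "c \<noteq> 0" for c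
    using that by (subst m) (auto intro!: eq_matI)
  have car: "c \<cdot>\<^sub>m 1\<^sub>m n \<in> carrier (GL TYPE('a) n)" if "c \<noteq> 0" for c
    using that inv[OF that] inv[of "inverse c"]
    by (auto simp: carrier_GL intro!: bexI[of _ "inverse c \<cdot>\<^sub>m 1\<^sub>m n"])
  have inv': "inv\<^bsub>GL TYPE('a) n\<^esub> (c \<cdot>\<^sub>m 1\<^sub>m n) = inverse c \<cdot>\<^sub>m 1\<^sub>m n" if "c \<noteq> 0" for c
    using that inv[of "inverse c"] car[of c] car[of "inverse c"]
    by (intro G.inv_equality) (auto simp: mult_GL one_GL)
  have prod: "(c \<cdot>\<^sub>m 1\<^sub>m n) * (d \<cdot>\<^sub>m 1\<^sub>m n) = (c * d) \<cdot>\<^sub>m (1\<^sub>m n :: 'a mat)" for c d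
    by (subst m) (auto intro!: eq_matI)
  have one: "\<one>\<^bsub>GL TYPE('a) n\<^esub> \<in> ?S"
    unfolding scalar_mats_def one_GL by (auto intro!: exI[of _ 1] eq_matI)
  have "subgroup ?S (GL TYPE('a) n)"
  proof (rule G.subgroupI)
    show "?S \<subseteq> carrier (GL TYPE('a) n)" using car by (auto simp: scalar_mats_def)
    show "?S \<noteq> {}" using one by auto
    show "inv\<^bsub>GL TYPE('a) n\<^esub> a \<in> ?S" if a: "a \<in> ?S" for a
    proof -
      from a obtain c where "c \<noteq> 0" "a = c \<cdot>\<^sub>m 1\<^sub>m n" by (auto simp: scalar_mats_def)
      then show ?thesis using inv'[of c] nonzero_imp_inverse_nonzero[of c]
        unfolding scalar_mats_def by blast
    qed
    show "a \<otimes>\<^bsub>GL TYPE('a) n\<^esub> d \<in> ?S" if ad: "a \<in> ?S" "d \<in> ?S" for a d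
    proof -
      from ad obtain c e where "c \<noteq> 0" "a = c \<cdot>\<^sub>m 1\<^sub>m n" "e \<noteq> 0" "d = e \<cdot>\<^sub>m 1\<^sub>m n"
        by (auto simp: scalar_mats_def)
      then show ?thesis using prod[of c e] no_zero_divisors[of c e]
        unfolding scalar_mats_def mult_GL by blast
    qed
  qed
  then show ?thesis
    unfolding G.normal_inv_iff
  proof (intro conjI ballI)
    fix P a assume P: "P \<in> carrier (GL TYPE('a) n)" and a: "a \<in> ?S"
    from a obtain c where c: "c \<noteq> 0" "a = c \<cdot>\<^sub>m 1\<^sub>m n" by (auto simp: scalar_mats_def)
    have Pc: "P \<in> carrier_mat n n" using P by (simp add: carrier_GL)
    have "P \<otimes>\<^bsub>GL TYPE('a) n\<^esub> a = a \<otimes>\<^bsub>GL TYPE('a) n\<^esub> P"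
      by (simp add: mult_GL c m[OF Pc])
    moreover have "a \<in> carrier (GL TYPE('a) n)" using c car by simp
    ultimately have "P \<otimes>\<^bsub>GL TYPE('a) n\<^esub> a \<otimes>\<^bsub>GL TYPE('a) n\<^esub> inv\<^bsub>GL TYPE('a) n\<^esub> P = a"
      using P G.inv_solve_right' by (simp add: G.m_assoc)
    then show "P \<otimes>\<^bsub>GL TYPE('a) n\<^esub> a \<otimes>\<^bsub>GL TYPE('a) n\<^esub> inv\<^bsub>GL TYPE('a) n\<^esub> P \<in> ?S"
      using a by simp
  qed
qed

lemma group_PGL: "group (PGL TYPE('a::field) n)"
  unfolding PGL_def by (rule normal.factorgroup_is_group[OF scalar_mats_normal])

end

(*
  Burnside's lemma counts the orbits as the average number of m-dimensional subspaces of W fixed by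
  P in GL(V), where W is the square of V. The q - 1 scalars contribute |Gr|/|PGL|, and K >= 1, so it
  suffices that all other P together contribute at most q^(-c n^2) |Gr|, where
  |Gr| >= q^(m (N - m)) with N = dim W ~ n^2.

  Let T be the action of P on W and U an invariant subspace. Either U contains t independent pairs
  u, T u, so that U is determined by m - t vectors, which leaves at most q^(N (m - t)) such U; or T
  is scalar on U modulo a subspace of dimension at most 2 (t - 1), so that U meets an eigenspace of T
  in dimension at least m - 2 t. If V contains k independent pairs v, P v, every eigenspace of T has
  codimension at least d = k (n - 2 k), which saves a factor of about q^(m d) in the number of U of
  the second kind. For a large constant k this beats |GL(V)| <= q^(n^2). The exceptional P are scalar
  modulo a subspace of bounded dimension, hence only q^O(n) in number, and for them k = 1 suffices.
*)

theory Submission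
  imports Defs
begin

section \<open>Counting in vector spaces over a finite field\<close>

text \<open>No normal form, minimal polynomial or centralizer of P enters, so no field extension
  arises, and one dichotomy for an arbitrary linear map serves both T on U and P on V. The two kinds
  of U impose separate conditions. With m ~ C n, the bound for the first kind lies below |Gr| by the
  exponent N t - m^2; as N >= n^2 / 8, a t depending only on C makes this larger than the n^2 lost
  to |GL(V)|. That t stays bounded matters for the second kind too: there it enters only through 2
  t, which shifts the exponent by O(n). The saving m d is about C k n^2, so k about 3 / C is enough.
  The obstacle is that a single pair saves only about C n^2, less than n^2 for small C. Hence the
  two thresholds, k and 1, for the number of pairs in V, and the choice of c below C.\<close>

lemma span_insert_image:
  "fvs.span (insert x B) = (\<lambda>(c, y). fscale c x + y) ` (UNIV \<times> fvs.span B)"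
proof (intro equalityI subsetI)
  fix z assume "z \<in> fvs.span (insert x B)"
  then obtain k where "z - fscale k x \<in> fvs.span B"
    by (auto simp: fvs.span_breakdown_eq)
  then show "z \<in> (\<lambda>(c, y). fscale c x + y) ` (UNIV \<times> fvs.span B)"
    by (intro image_eqI[of _ _ "(k, z - fscale k x)"]) auto
next
  fix z assume "z \<in> (\<lambda>(c, y). fscale c x + y) ` (UNIV \<times> fvs.span B)"
  then obtain c y where "z = fscale c x + y" "y \<in> fvs.span B" by auto
  then show "z \<in> fvs.span (insert x B)"
    unfolding fvs.span_breakdown_eq by (intro exI[of _ c]) simp
qed

lemma card_span_le:
  fixes B :: "('b \<Rightarrow> 'a::{field, finite}) set"
  assumes "finite B"
  shows "finite (fvs.span B) \<and> card (fvs.span B) \<le> CARD('a) ^ card B"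
  using assms
proof (induction B rule: finite_induct)
  case (insert x B)
  let ?P = "(UNIV :: 'a set) \<times> fvs.span B"
  have "finite ?P" using insert by simp
  moreover have "card ?P \<le> CARD('a) ^ card (insert x B)"
    using insert by (simp add: card_cartesian_product)
  ultimately show ?case
    unfolding span_insert_image by (meson card_image_le finite_imageI le_trans)
qed simp

lemmas finite_span = card_span_le[THEN conjunct1]

lemma card_span_independent:
  fixes B :: "('b \<Rightarrow> 'a::{field, finite}) set"
  assumes "finite B" "fvs.independent B"
  shows "card (fvs.span B) = CARD('a) ^ card B"
  using assms
proof (induction B rule: finite_induct)
  case (insert x B)
  then have x: "x \<notin> fvs.span B" and B: "fvs.independent B"
    by (auto simp: fvs.independent_insert)
  have "inj_on (\<lambda>(c, y). fscale c x + y) (UNIV \<times> fvs.span B)"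
  proof (rule inj_onI, clarify)
    fix c d y z assume yz: "y \<in> fvs.span B" "z \<in> fvs.span B" "fscale c x + y = fscale d x + z"
    then have "fscale (c - d) x = z - y" by (simp add: fvs.scale_left_diff_distrib algebra_simps)
    then have "fscale (c - d) x \<in> fvs.span B" using yz fvs.span_diff by metis
    then have "fscale (inverse (c - d)) (fscale (c - d) x) \<in> fvs.span B" by (rule fvs.span_scale)
    then have "c = d" using x by (cases "c = d") simp_all
    then show "c = d \<and> y = z" using yz by simp
  qed
  then show ?case unfolding span_insert_image
    using insert B by (simp add: card_image card_cartesian_product)
qed simp

lemma subspace_basis:
  fixes U :: "('b \<Rightarrow> 'a::{field, finite}) set"
  assumes "fvs.subspace U" "finite U" "B \<subseteq> U" "fvs.independent B"
  obtains B' where "B \<subseteq> B'" "B' \<subseteq> U" "fvs.independent B'" "fvs.span B' = U" "finite B'"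
proof -
  obtain B' where "B \<subseteq> B'" "B' \<subseteq> U" "fvs.independent B'" "U \<subseteq> fvs.span B'"
    using fvs.maximal_independent_subset_extend[OF assms(3,4)] by blast
  moreover from this have "fvs.span B' = U" using assms(1) fvs.span_minimal by blast
  ultimately show ?thesis using that assms(2) finite_subset by metis
qed

lemma card_subspace:
  fixes U :: "('b \<Rightarrow> 'a::{field, finite}) set"
  assumes "fvs.subspace U" "finite U"
  shows "card U = CARD('a) ^ fvs.dim U"
proof -
  obtain B where B: "fvs.independent B" "fvs.span B = U" "finite B"
    using subspace_basis[OF assms empty_subsetI fvs.independent_empty] by metis
  then show ?thesis using card_span_independent[of B] fvs.dim_span_eq_card_independent by metis
qed

lemma card_field_gt_1: "1 < CARD('a::{field, finite})"
proof -
  have "card {0, 1 :: 'a} \<le> CARD('a)" by (rule card_mono) auto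
  then show ?thesis by simp
qed

section \<open>Ordered independent families\<close>

text \<open>Families grow at the head: the head is the vector chosen last, and the length of its
  tail is its position. Letting \<open>S\<close> depend on the position allows the first vectors of
  a basis to come from an eigenspace and the others from all of \<open>U\<close>.\<close>

fun adapted :: "(nat \<Rightarrow> ('b \<Rightarrow> 'a::field) set) \<Rightarrow> ('b \<Rightarrow> 'a) list \<Rightarrow> bool" where
  "adapted S [] \<longleftrightarrow> True"
| "adapted S (x # xs) \<longleftrightarrow> adapted S xs \<and> x \<in> S (length xs) \<and> x \<notin> fvs.span (set xs)"

definition adapted_lists :: "(nat \<Rightarrow> ('b \<Rightarrow> 'a::field) set) \<Rightarrow> nat \<Rightarrow> ('b \<Rightarrow> 'a) list set" where
  "adapted_lists S k = {xs. length xs = k \<and> adapted S xs}"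

lemma adapted_independent: "adapted S xs \<Longrightarrow> fvs.independent (set xs) \<and> card (set xs) = length xs"
  by (induction xs) (auto simp: fvs.independent_insert fvs.span_base fvs.independent_empty)

lemma adapted_subset: "adapted S xs \<Longrightarrow> set xs \<subseteq> (\<Union>i<length xs. S i)"
  by (induction xs) (auto simp: lessThan_Suc)

lemma adapted_mono: "adapted S xs \<Longrightarrow> (\<And>i. i < length xs \<Longrightarrow> S i \<subseteq> S' i) \<Longrightarrow> adapted S' xs"
  by (induction xs) (auto simp: less_Suc_eq)

lemma adapted_span:
  assumes "adapted S xs"
  shows "card (fvs.span (set xs) :: ('b \<Rightarrow> 'a::{field, finite}) set) = CARD('a) ^ length xs"
  using adapted_independent[OF assms] card_span_independent[of "set xs"] by simp

lemma adapted_lists_Suc: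
  "adapted_lists S (Suc k)
    = (\<lambda>(xs, x). x # xs) ` (SIGMA xs:adapted_lists S k. S k - fvs.span (set xs))"
  by (auto simp: adapted_lists_def image_iff length_Suc_conv Bex_def)

lemma finite_adapted_lists: "(\<And>i. i < k \<Longrightarrow> finite (S i)) \<Longrightarrow> finite (adapted_lists S k)"
proof (induction k)
  case 0 then show ?case
    by (rule_tac finite_subset[of _ "{[]}"]) (auto simp: adapted_lists_def)
qed (auto simp: adapted_lists_Suc)

lemma card_adapted_lists_Suc:
  assumes "\<And>i. i < Suc k \<Longrightarrow> finite (S i)"
  shows "card (adapted_lists S (Suc k))
    = (\<Sum>xs\<in>adapted_lists S k. card (S k - fvs.span (set xs)))"
proof -
  have "inj_on (\<lambda>(xs, x). x # xs) (SIGMA xs:adapted_lists S k. S k - fvs.span (set xs))"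
    by (auto intro: inj_onI)
  then show ?thesis unfolding adapted_lists_Suc using assms
    by (subst card_image) (auto simp: finite_adapted_lists)
qed

lemma adapted_lists_0: "adapted_lists S 0 = {[]}"
  by (auto simp: adapted_lists_def)

lemma card_adapted_lists_le:
  assumes "\<And>i. i < k \<Longrightarrow> finite (S i)"
  shows "card (adapted_lists S k) \<le> (\<Prod>i<k. card (S i))"
  using assms
proof (induction k)
  case (Suc k)
  have "card (adapted_lists S (Suc k)) = (\<Sum>xs\<in>adapted_lists S k. card (S k - fvs.span (set xs)))"
    using Suc.prems by (rule card_adapted_lists_Suc)
  also have "\<dots> \<le> (\<Sum>xs\<in>adapted_lists S k. card (S k))"
    using Suc.prems by (intro sum_mono card_mono) auto
  also have "\<dots> \<le> (\<Prod>i<k. card (S i)) * card (S k)"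
    using Suc by simp
  finally show ?case by simp
qed (simp add: adapted_lists_0)

text \<open>The span of the first \<open>i\<close> vectors has exactly q^i elements but need not lie
  in \<open>S i\<close>, so removing it costs at most q^i choices. Where the subtraction truncates
  to 0 the bound is trivial.\<close>

lemma card_adapted_lists_ge:
  fixes S :: "nat \<Rightarrow> ('b \<Rightarrow> 'a::{field, finite}) set"
  assumes "\<And>i. i < k \<Longrightarrow> finite (S i)"
  shows "(\<Prod>i<k. card (S i) - CARD('a) ^ i) \<le> card (adapted_lists S k)"
  using assms
proof (induction k)
  case (Suc k)
  have "card (S k) - CARD('a) ^ k \<le> card (S k - fvs.span (set xs))"
    if "xs \<in> adapted_lists S k" for xs
    using diff_card_le_card_Diff[of "fvs.span (set xs)" "S k"] that adapted_span[of S xs]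
    by (auto simp: adapted_lists_def finite_span)
  then have "(\<Sum>xs\<in>adapted_lists S k. card (S k) - CARD('a) ^ k)
      \<le> (\<Sum>xs\<in>adapted_lists S k. card (S k - fvs.span (set xs)))" by (rule sum_mono)
  also have "\<dots> = card (adapted_lists S (Suc k))"
    using Suc.prems by (rule card_adapted_lists_Suc[symmetric])
  finally have "(\<Sum>xs\<in>adapted_lists S k. card (S k) - CARD('a) ^ k)
      \<le> card (adapted_lists S (Suc k))" .
  then have "card (adapted_lists S k) * (card (S k) - CARD('a) ^ k) \<le> card (adapted_lists S (Suc k))"
    by simp
  moreover have "(\<Prod>i<k. card (S i) - CARD('a) ^ i) * (card (S k) - CARD('a) ^ k)
      \<le> card (adapted_lists S k) * (card (S k) - CARD('a) ^ k)"
    using Suc by (intro mult_right_mono) auto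
  ultimately show ?case unfolding prod.lessThan_Suc by (rule order_trans[rotated])
qed (simp add: adapted_lists_0)

text \<open>Equality, because now every span that is removed lies inside \<open>U\<close>. For
  \<open>k\<close> above the dimension both sides vanish.\<close>

lemma card_adapted_lists_const:
  fixes U :: "('b \<Rightarrow> 'a::{field, finite}) set"
  assumes "finite U" "fvs.subspace U"
  shows "card (adapted_lists (\<lambda>_. U) k) = (\<Prod>i<k. card U - CARD('a) ^ i)"
proof (induction k)
  case (Suc k)
  have "card (U - fvs.span (set xs)) = card U - CARD('a) ^ k"
    if xs: "xs \<in> adapted_lists (\<lambda>_. U) k" for xs
  proof -
    have "set xs \<subseteq> U" using adapted_subset[of "\<lambda>_. U" xs] xs
      by (auto simp: adapted_lists_def split: if_splits)
    then have "fvs.span (set xs) \<subseteq> U" using fvs.span_minimal assms by blast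
    then show ?thesis using xs adapted_span[of "\<lambda>_. U" xs]
      by (simp add: adapted_lists_def card_Diff_subset finite_span)
  qed
  then show ?case using Suc by (simp add: card_adapted_lists_Suc assms)
qed (simp add: adapted_lists_0)

section \<open>Kernels, images and coset representatives\<close>

text \<open>One half of |W| = |kernel| |image|: adding a kernel element to a fixed preimage of an
  image element is injective. It turns a large image of T - \<mu> into a small eigenspace.\<close>

lemma card_kernel_image_le:
  fixes f :: "'v::ab_group_add \<Rightarrow> 'w::ab_group_add"
  assumes f: "\<And>x y. f (x + y) = f x + f y" and W: "finite W"
    and add: "\<And>x y. x \<in> W \<Longrightarrow> y \<in> W \<Longrightarrow> x + y \<in> W"
  shows "card {x \<in> W. f x = 0} * card (f ` W) \<le> card W"
proof -
  let ?g = "inv_into W f"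
  have "inj_on (\<lambda>(x, y). x + ?g y) ({x \<in> W. f x = 0} \<times> f ` W)"
  proof (rule inj_onI, clarify)
    fix x y x' y' assume a: "x \<in> W" "f x = 0" "y \<in> W" "x' \<in> W" "f x' = 0" "y' \<in> W"
      "x + ?g (f y) = x' + ?g (f y')"
    then have "f x + f (?g (f y)) = f x' + f (?g (f y'))" by (metis f)
    moreover have "f (?g (f y)) = f y" "f (?g (f y')) = f y'"
      using a by (simp_all add: f_inv_into_f)
    ultimately have "f y = f y'" using a by simp
    then show "x = x' \<and> f y = f y'" using a by simp
  qed
  moreover have "(\<lambda>(x, y). x + ?g y) ` ({x \<in> W. f x = 0} \<times> f ` W) \<subseteq> W"
    by (auto intro!: add inv_into_into)
  ultimately have "card ({x \<in> W. f x = 0} \<times> f ` W) \<le> card W"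
    using W by (meson card_inj_on_le)
  then show ?thesis by (simp add: card_cartesian_product)
qed

text \<open>The other half: x is recovered from f x and from its difference to the fixed preimage of
  f x. It turns a small image of T - c on U into a large intersection with an eigenspace.\<close>

lemma card_le_kernel_image:
  fixes f :: "'v::ab_group_add \<Rightarrow> 'w::ab_group_add"
  assumes f: "\<And>x y. f (x - y) = f x - f y" and W: "finite W"
    and diff: "\<And>x y. x \<in> W \<Longrightarrow> y \<in> W \<Longrightarrow> x - y \<in> W"
  shows "card W \<le> card {x \<in> W. f x = 0} * card (f ` W)"
proof -
  let ?g = "inv_into W f"
  have "inj_on (\<lambda>x. (x - ?g (f x), f x)) W"
    by (rule inj_onI) auto
  moreover have "(\<lambda>x. (x - ?g (f x), f x)) ` W \<subseteq> {x \<in> W. f x = 0} \<times> f ` W"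
    by (auto intro!: diff inv_into_into simp: f f_inv_into_f)
  ultimately have "card W \<le> card ({x \<in> W. f x = 0} \<times> f ` W)"
    using W by (intro card_inj_on_le) auto
  then show ?thesis by (simp add: card_cartesian_product)
qed

text \<open>Vectors congruent modulo the group \<open>Z\<close> satisfy the same predicate under
  \<open>SOME\<close>, so they get the same representative; each vector is its representative plus
  an element of \<open>Z\<close>, whence the bound on \<open>card V\<close>.\<close>

lemma exists_transversal:
  fixes V Z :: "'v::ab_group_add set"
  assumes "finite V" "finite Z" "\<And>x y. x \<in> Z \<Longrightarrow> y \<in> Z \<Longrightarrow> x - y \<in> Z" "Z \<noteq> {}"
  obtains Y where "Y \<subseteq> V" "\<And>x y. x \<in> Y \<Longrightarrow> y \<in> Y \<Longrightarrow> x - y \<in> Z \<Longrightarrow> x = y"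
    "card V \<le> card Y * card Z"
proof -
  have 0: "0 \<in> Z" using assms(3,4) by (metis diff_self ex_in_conv)
  have neg: "- x \<in> Z" if "x \<in> Z" for x using assms(3)[OF 0 that] by simp
  have plus: "x + y \<in> Z" if "x \<in> Z" "y \<in> Z" for x y
    using assms(3)[OF that(1) neg[OF that(2)]] by simp
  define f where "f v = (SOME u. u \<in> V \<and> v - u \<in> Z)" for v
  have f: "f v \<in> V" "v - f v \<in> Z" if "v \<in> V" for v
    using someI[of "\<lambda>u. u \<in> V \<and> v - u \<in> Z" v] that 0 by (auto simp: f_def)
  have fc: "f v = f w" if "v - w \<in> Z" for v w
  proof -
    have "v - u \<in> Z \<longleftrightarrow> w - u \<in> Z" for u
      using plus[OF that, of "w - u"] assms(3)[OF _ that, of "v - u"] by (auto simp: algebra_simps)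
    then show ?thesis by (simp add: f_def)
  qed
  have ff: "f (f v) = f v" if "v \<in> V" for v using fc[OF f(2)[OF that]] by simp
  show ?thesis
  proof
    show "f ` V \<subseteq> V" using f by auto
    show "x = y" if "x \<in> f ` V" "y \<in> f ` V" "x - y \<in> Z" for x y
      using that fc ff by (metis imageE)
    have "V \<subseteq> (\<lambda>(y, z). y + z) ` (f ` V \<times> Z)"
    proof
      fix v assume "v \<in> V"
      then show "v \<in> (\<lambda>(y, z). y + z) ` (f ` V \<times> Z)"
        using f by (intro image_eqI[of _ _ "(f v, v - f v)"]) auto
    qed
    then have "card V \<le> card (f ` V \<times> Z)"
      using assms by (meson card_image_le card_mono finite_SigmaI finite_imageI le_trans)
    then show "card V \<le> card (f ` V) * card Z" by (simp add: card_cartesian_product)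
  qed
qed

section \<open>Invariant subspaces of a linear map\<close>

lemma subspace_not_subset_span:
  fixes U :: "('b \<Rightarrow> 'a::{field, finite}) set"
  assumes "fvs.subspace U" "finite U" "finite X" "card X < fvs.dim U"
  obtains u where "u \<in> U" "u \<notin> fvs.span X"
proof -
  have "\<not> U \<subseteq> fvs.span X" using fvs.dim_le_card[of U X] assms by auto
  then show ?thesis using that by blast
qed

text \<open>
  Independent pairs \<open>u\<close>, \<open>T u\<close> are collected greedily. The process stops only when \<open>T\<close> acts on
  the quotient by the span of the pairs found so far with every vector as an eigenvector, that is,
  as a scalar.
\<close>

lemma independent_pairs_or_near_scalar:
  fixes U :: "('b \<Rightarrow> 'a::{field, finite}) set"
  assumes lin: "Vector_Spaces.linear fscale fscale T" and U: "fvs.subspace U" "finite U"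
    and TU: "T ` U \<subseteq> U" and t: "2 * t \<le> fvs.dim U"
  shows "(\<exists>A\<subseteq>U. card A = t \<and> fvs.independent (A \<union> T ` A) \<and> card (A \<union> T ` A) = 2 * t) \<or>
    (\<exists>c. \<exists>X\<subseteq>U. card X \<le> 2 * (t - 1) \<and> (\<forall>u\<in>U. T u - fscale c u \<in> fvs.span X))"
  using t
proof (induction t)
  case 0
  then show ?case by (intro disjI1 exI[of _ "{}"]) (simp add: fvs.independent_empty)
next
  case (Suc t)
  interpret T: Vector_Spaces.linear fscale fscale T by (rule lin)
  note IH = Suc.IH[OF order_trans[OF mult_le_mono2[OF le_SucI[OF order_refl]] Suc.prems]]
  show ?case
  proof (cases "\<exists>c. \<exists>X\<subseteq>U. card X \<le> 2 * (t - 1) \<and> (\<forall>u\<in>U. T u - fscale c u \<in> fvs.span X)")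
    case True
    then obtain c X where "X \<subseteq> U" "card X \<le> 2 * (t - 1)" "\<forall>u\<in>U. T u - fscale c u \<in> fvs.span X"
      by blast
    moreover from this have "card X \<le> 2 * (Suc t - 1)" by simp
    ultimately show ?thesis by blast
  next
    case False
    then obtain A where A: "A \<subseteq> U" "card A = t" "fvs.independent (A \<union> T ` A)"
      "card (A \<union> T ` A) = 2 * t" using IH by blast
    define X where "X = A \<union> T ` A"
    have fA: "finite A" using A U finite_subset by blast
    have X: "X \<subseteq> U" "finite X" "fvs.independent X" "card X = 2 * t"
      using A TU fA by (auto simp: X_def)
    show ?thesis
    proof (cases "\<exists>u\<in>U. u \<notin> fvs.span X \<and> T u \<notin> fvs.span (insert u X)")
      case True
      then obtain u where u: "u \<in> U" "u \<notin> fvs.span X" "T u \<notin> fvs.span (insert u X)" by blast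
      have e: "insert u A \<union> T ` insert u A = insert (T u) (insert u X)" by (auto simp: X_def)
      have n: "u \<notin> X" "T u \<notin> insert u X" using u(2,3) fvs.span_base by blast+
      then have "u \<notin> A" by (simp add: X_def)
      moreover have "fvs.independent (insert (T u) (insert u X))"
        using u X by (intro fvs.independent_insertI) auto
      moreover have "card (insert (T u) (insert u X)) = 2 * Suc t"
        using n X by simp
      ultimately show ?thesis using u A fA
        by (intro disjI1 exI[of _ "insert u A"] conjI) (simp_all only: e, auto)
    next
      case stuck: False
      define E where "E c u \<longleftrightarrow> T u - fscale c u \<in> fvs.span X" for c u
      have ex: "\<exists>c. E c u" if "u \<in> U" "u \<notin> fvs.span X" for u
        using stuck that by (auto simp: E_def fvs.span_breakdown_eq)
      have Ediff: "E c (u - w)" if "E c u" "E c w" for c u w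
        using fvs.span_diff[OF that[unfolded E_def]] unfolding E_def
        by (simp add: T.diff fvs.scale_right_diff_distrib algebra_simps)
      obtain v where v: "v \<in> U" "v \<notin> fvs.span X"
        using subspace_not_subset_span[OF U X(2)] X Suc.prems by auto
      \<comment> \<open>The dimension is at least 2 t + 2 and \<open>X\<close> has 2 t elements, so
        there is room for two vectors \<open>v\<close>, \<open>w\<close> independent modulo
        \<open>X\<close>. The second one handles the vectors in the span of
        \<open>insert v X\<close>.\<close>
      have "card (insert v X) < fvs.dim U"
        using card_insert_le_m1[of "Suc (2 * t)" X v] X Suc.prems by simp
      then obtain w where w: "w \<in> U" "w \<notin> fvs.span (insert v X)"
        using subspace_not_subset_span[OF U, of "insert v X"] X by auto
      obtain c where c: "E c v" using ex v by blast
      have sub: "fvs.span X \<subseteq> fvs.span (insert v X)" by (intro fvs.span_mono) auto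
      have vs: "v \<in> fvs.span (insert v X)" by (simp add: fvs.span_base)
      \<comment> \<open>Modulo the span of \<open>X\<close> the vectors v, x and v + x are
        eigenvectors, and v, x are independent; comparing coefficients forces their three
        eigenvalues to coincide.\<close>
      have E1: "E c x" if x: "x \<in> U" "x \<notin> fvs.span (insert v X)" for x
      proof -
        have "v + x \<notin> fvs.span (insert v X)"
          using x vs fvs.span_add_eq by blast
        moreover have "v + x \<in> U" using v x U fvs.subspace_add by blast
        ultimately obtain e where e: "E e (v + x)" using ex sub by blast
        obtain d where d: "E d x" using ex x sub by blast
        have "(T (v + x) - fscale e (v + x)) - (T v - fscale c v) - (T x - fscale d x) \<in> fvs.span X"
          using fvs.span_diff[OF fvs.span_diff[OF e[unfolded E_def] c[unfolded E_def]] d[unfolded E_def]] .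
        also have "(T (v + x) - fscale e (v + x)) - (T v - fscale c v) - (T x - fscale d x)
            = fscale (c - e) v + fscale (d - e) x"
          by (simp add: T.add fvs.scale_right_distrib fvs.scale_left_diff_distrib)
        finally have *: "fscale (c - e) v + fscale (d - e) x \<in> fvs.span X" .
        then have "fscale (c - e) v + fscale (d - e) x - fscale (c - e) v \<in> fvs.span (insert v X)"
          using sub vs by (intro fvs.span_diff fvs.span_scale) auto
        then have "fscale (inverse (d - e)) (fscale (d - e) x) \<in> fvs.span (insert v X)"
          by (intro fvs.span_scale[of "fscale _ _"]) simp
        then have de: "d = e" using x(2) by (cases "d = e") simp_all
        with * have "fscale (inverse (c - e)) (fscale (c - e) v) \<in> fvs.span X"
          by (intro fvs.span_scale[of "fscale _ _"]) simp
        then have "c = e" using v(2) by (cases "c = e") simp_all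
        then show ?thesis using d de by simp
      qed
      \<comment> \<open>A vector u in the span of \<open>insert v X\<close> is shifted out of it by
        \<open>w\<close>; both w + u and \<open>w\<close> have eigenvalue c, hence so has their
        difference u.\<close>
      have "E c u" if u: "u \<in> U" for u
      proof (cases "u \<in> fvs.span (insert v X)")
        case True
        have "w + u \<notin> fvs.span (insert v X)" using w True
          using fvs.span_add_eq2 by blast
        then have "E c (w + u)" using E1 w u U fvs.subspace_add by blast
        from Ediff[OF this E1[OF w]] show ?thesis by simp
      qed (use E1 u in blast)
      then have "\<forall>u\<in>U. T u - fscale c u \<in> fvs.span X" unfolding E_def by (rule ballI)
      moreover have "card X \<le> 2 * (Suc t - 1)" using X by simp
      ultimately show ?thesis by (intro disjI2 exI[of _ c] exI[of _ X] conjI X(1))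
    qed
  qed
qed

section \<open>Double counting of subspaces by ordered bases\<close>

text \<open>Since q >= 2, each basis vector costs at most one power of q. Over a whole basis this
  amounts to q^m, which is negligible against q^(c n^2).\<close>

lemma power_diff_ge:
  fixes q :: nat
  assumes "1 < q" "i < k"
  shows "q ^ (k - 1) \<le> q ^ k - q ^ i"
proof -
  have "q ^ i \<le> q ^ (k - 1)" using assms by (intro power_increasing) auto
  moreover have "2 * q ^ (k - 1) \<le> q * q ^ (k - 1)" using assms by (intro mult_right_mono) auto
  moreover have "q * q ^ (k - 1) = q ^ k" using assms by (cases k) auto
  ultimately show ?thesis by linarith
qed

lemma adapted_lists_span:
  fixes U :: "('b \<Rightarrow> 'a::{field, finite}) set"
  assumes U: "fvs.subspace U" "finite U" and S: "\<And>i. i < fvs.dim U \<Longrightarrow> S i \<subseteq> U"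
    and xs: "xs \<in> adapted_lists S (fvs.dim U)"
  shows "fvs.span (set xs) = U"
proof -
  have xs': "length xs = fvs.dim U" "adapted S xs" using xs by (auto simp: adapted_lists_def)
  have "set xs \<subseteq> U" using adapted_subset[OF xs'(2)] S xs'(1) by auto
  then have "fvs.span (set xs) \<subseteq> U" using U fvs.span_minimal by blast
  then show ?thesis using U xs' adapted_span[OF xs'(2)] card_subspace[OF U]
    by (intro card_subset_eq) auto
qed

definition Gras :: "('b \<Rightarrow> 'a::field) set \<Rightarrow> nat \<Rightarrow> ('b \<Rightarrow> 'a) set set" where
  "Gras W m = {U. fvs.subspace U \<and> U \<subseteq> W \<and> fvs.dim U = m}"

lemma finite_Gras: "finite W \<Longrightarrow> finite (Gras W m)"
  by (rule finite_subset[of _ "Pow W"]) (auto simp: Gras_def)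

text \<open>A list of length m adapted to subsets of U spans U, so distinct U have disjoint sets of
  lists, and the sum counts lists that are all adapted to \<open>R\<close>.\<close>

lemma sum_card_adapted_lists_le:
  fixes W :: "('b \<Rightarrow> 'a::{field, finite}) set"
  assumes W: "finite W" and G: "G \<subseteq> Gras W m"
    and S: "\<And>U i. U \<in> G \<Longrightarrow> i < m \<Longrightarrow> S U i \<subseteq> U \<inter> R i" and R: "\<And>i. i < m \<Longrightarrow> R i \<subseteq> W"
  shows "(\<Sum>U\<in>G. card (adapted_lists (S U) m)) \<le> (\<Prod>i<m. card (R i))"
proof -
  have fR: "finite (R i)" if "i < m" for i using R[OF that] W finite_subset by blast
  have fS: "finite (S U i)" if "U \<in> G" "i < m" for U i
    using S[OF that] fR[OF that(2)] finite_subset by blast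
  have fG: "finite G" using G finite_Gras[OF W] finite_subset by blast
  have sp: "fvs.span (set xs) = U" if "U \<in> G" "xs \<in> adapted_lists (S U) m" for U xs
  proof -
    have "fvs.subspace U" "U \<subseteq> W" "fvs.dim U = m" using G that by (auto simp: Gras_def)
    then show ?thesis using adapted_lists_span[of U "S U" xs] S[OF that(1)] that W
      by (meson finite_subset le_inf_iff)
  qed
  have "(\<Sum>U\<in>G. card (adapted_lists (S U) m)) = card (\<Union>U\<in>G. adapted_lists (S U) m)"
    using fG sp by (intro card_UN_disjoint[symmetric]) (auto intro!: finite_adapted_lists fS)
  also have "\<dots> \<le> card (adapted_lists R m)"
  proof (rule card_mono)
    show "finite (adapted_lists R m)" by (rule finite_adapted_lists) (rule fR)
    show "(\<Union>U\<in>G. adapted_lists (S U) m) \<subseteq> adapted_lists R m"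
      unfolding adapted_lists_def
    proof clarify
      fix U xs assume U: "U \<in> G" and xs: "adapted (S U) xs" "m = length xs"
      from xs(1) show "length xs = length xs \<and> adapted R xs"
        using S[OF U] xs(2) by (intro conjI refl adapted_mono[OF xs(1)]) auto
    qed
  qed
  also have "\<dots> \<le> (\<Prod>i<m. card (R i))" by (rule card_adapted_lists_le) (rule fR)
  finally show ?thesis .
qed

lemma prod_if_lessThan:
  fixes f g :: nat
  assumes "k \<le> m"
  shows "(\<Prod>i<m. if i < k then f else g) = f ^ k * g ^ (m - k)"
proof -
  have "(\<Prod>i<m. if i < k then f else g)
      = (\<Prod>i\<in>{..<m} \<inter> {i. i < k}. f) * (\<Prod>i\<in>{..<m} \<inter> - {i. i < k}. g)"
    by (rule prod.If_cases) simp
  moreover have "{..<m} \<inter> {i. i < k} = {..<k}" "{..<m} \<inter> - {i. i < k} = {k..<m}"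
    using assms by auto
  ultimately show ?thesis by simp
qed

text \<open>Count ordered bases of U whose first m - s vectors lie in E. Each U has at least q to
  the displayed exponent of them, while all U together have at most |E|^(m - s) |W|^s. The product
  form avoids division in the naturals.\<close>

lemma card_subspaces_meeting_le:
  fixes W :: "('b \<Rightarrow> 'a::{field, finite}) set"
  assumes W: "finite W" and E: "E \<subseteq> W" and s: "s \<le> m"
  shows "card {U \<in> Gras W m. CARD('a) ^ (m - s) \<le> card (U \<inter> E)}
      * CARD('a) ^ ((m - s) * (m - s - 1) + s * (m - 1)) \<le> card E ^ (m - s) * card W ^ s"
proof -
  let ?q = "CARD('a)"
  define G where "G = {U \<in> Gras W m. ?q ^ (m - s) \<le> card (U \<inter> E)}"
  define S where "S U i = (if i < m - s then U \<inter> E else U)" for U :: "('b \<Rightarrow> 'a) set" and i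
  define R where "R i = (if i < m - s then E else W)" for i
  have q: "1 < ?q" by (rule card_field_gt_1)
  have "?q ^ ((m - s) * (m - s - 1) + s * (m - 1)) \<le> card (adapted_lists (S U) m)" if U: "U \<in> G" for U
  proof -
    have U': "fvs.subspace U" "finite U" "fvs.dim U = m" "?q ^ (m - s) \<le> card (U \<inter> E)"
      using U W finite_subset by (auto simp: G_def Gras_def)
    have "?q ^ ((m - s) * (m - s - 1) + s * (m - 1))
        = (?q ^ (m - s - 1)) ^ (m - s) * (?q ^ (m - 1)) ^ (m - (m - s))"
      using s by (simp add: power_add mult.commute flip: power_mult)
    also have "\<dots> = (\<Prod>i<m. if i < m - s then ?q ^ (m - s - 1) else ?q ^ (m - 1))"
      by (subst prod_if_lessThan) auto
    also have "\<dots> \<le> (\<Prod>i<m. card (S U i) - ?q ^ i)"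
    proof (rule prod_mono, safe)
      fix i assume i: "i < m"
      show "(if i < m - s then ?q ^ (m - s - 1) else ?q ^ (m - 1)) \<le> card (S U i) - ?q ^ i"
        using power_diff_ge[OF q, of i "m - s"] power_diff_ge[OF q i] U'(4) card_subspace[OF U'(1,2)]
          U'(3) by (auto simp: S_def)
    qed
    also have "\<dots> \<le> card (adapted_lists (S U) m)"
      by (rule card_adapted_lists_ge) (use U' in \<open>auto simp: S_def\<close>)
    finally show ?thesis .
  qed
  then have "card G * ?q ^ ((m - s) * (m - s - 1) + s * (m - 1)) \<le> (\<Sum>U\<in>G. card (adapted_lists (S U) m))"
    using sum_mono[of G "\<lambda>_. ?q ^ ((m - s) * (m - s - 1) + s * (m - 1))"] by simp
  also have "\<dots> \<le> (\<Prod>i<m. card (R i))"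
  proof (rule sum_card_adapted_lists_le[OF W])
    show "G \<subseteq> Gras W m" by (auto simp: G_def)
    show "S U i \<subseteq> U \<inter> R i" if "U \<in> G" for U i using that by (auto simp: G_def S_def R_def Gras_def)
    show "R i \<subseteq> W" for i using E by (auto simp: R_def)
  qed
  also have "\<dots> = (\<Prod>i<m. if i < m - s then card E else card W)"
    by (intro prod.cong) (auto simp: R_def)
  also have "\<dots> = card E ^ (m - s) * card W ^ s"
    using s by (subst prod_if_lessThan) auto
  finally show ?thesis by (simp add: G_def)
qed

text \<open>The Gaussian binomial is the product of (q^N - q^i) / (q^m - q^i) over i < m, and each
  factor is at least q^(N - m). The proof multiplies by \<open>?P\<close>, the number of ordered
  bases of one U.\<close>

lemma card_Gras_ge:
  fixes W :: "('b \<Rightarrow> 'a::{field, finite}) set"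
  assumes W: "finite W" "fvs.subspace W" and m: "m \<le> fvs.dim W"
  shows "CARD('a) ^ (m * (fvs.dim W - m)) \<le> card (Gras W m)"
proof -
  let ?q = "CARD('a)" and ?N = "fvs.dim W"
  let ?P = "\<Prod>i<m. ?q ^ m - ?q ^ i"
  have q: "1 < ?q" by (rule card_field_gt_1)
  have pos: "0 < ?P" using q by (intro prod_pos) (auto intro: power_strict_increasing)
  have "?q ^ (m * (?N - m)) * ?P = (\<Prod>i<m. ?q ^ (?N - m) * (?q ^ m - ?q ^ i))"
    by (simp add: prod.distrib mult.commute flip: power_mult)
  also have "\<dots> \<le> (\<Prod>i<m. card W - ?q ^ i)"
  proof (rule prod_mono, safe)
    fix i
    have "?q ^ (?N - m) * (?q ^ m - ?q ^ i) = ?q ^ ?N - ?q ^ (?N - m) * ?q ^ i"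
      using m by (simp add: diff_mult_distrib2 flip: power_add)
    also have "\<dots> \<le> ?q ^ ?N - 1 * ?q ^ i" using q by (intro diff_le_mono2 mult_right_mono) auto
    finally show "?q ^ (?N - m) * (?q ^ m - ?q ^ i) \<le> card W - ?q ^ i"
      using card_subspace[OF W(2,1)] by simp
  qed
  also have "\<dots> = card (adapted_lists (\<lambda>_. W) m)"
    by (rule card_adapted_lists_const[symmetric]) (use W in auto)
  also have "\<dots> \<le> card (\<Union>U\<in>Gras W m. adapted_lists (\<lambda>_. U) m)"
  proof (rule card_mono)
    show "finite (\<Union>U\<in>Gras W m. adapted_lists (\<lambda>_. U) m)"
      using W finite_Gras[of W m] finite_subset
      by (auto intro!: finite_adapted_lists simp: Gras_def)
    show "adapted_lists (\<lambda>_. W) m \<subseteq> (\<Union>U\<in>Gras W m. adapted_lists (\<lambda>_. U) m)"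
    proof
      fix xs assume xs: "xs \<in> adapted_lists (\<lambda>_. W) m"
      then have xs': "length xs = m" "adapted (\<lambda>_. W) xs" by (auto simp: adapted_lists_def)
      have "set xs \<subseteq> W" using adapted_subset[OF xs'(2)] by (auto split: if_splits)
      then have "fvs.span (set xs) \<subseteq> W" using W fvs.span_minimal by blast
      moreover have "fvs.dim (fvs.span (set xs)) = m"
        using adapted_independent[OF xs'(2)] xs' by (simp add: fvs.dim_eq_card_independent)
      moreover have "adapted (\<lambda>_. fvs.span (set xs)) ys" if "adapted (\<lambda>_. W) ys" "set ys \<subseteq> set xs" for ys
        using that by (induction ys) (auto simp: fvs.span_base)
      ultimately show "xs \<in> (\<Union>U\<in>Gras W m. adapted_lists (\<lambda>_. U) m)"
        using xs' by (auto simp: Gras_def adapted_lists_def fvs.subspace_span)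
    qed
  qed
  also have "\<dots> \<le> (\<Sum>U\<in>Gras W m. card (adapted_lists (\<lambda>_. U) m))"
    by (rule card_UN_le[OF finite_Gras[OF W(1)]])
  also have "\<dots> = (\<Sum>U\<in>Gras W m. ?P)"
  proof (rule sum.cong[OF refl])
    fix U assume U: "U \<in> Gras W m"
    then have U': "fvs.subspace U" "finite U" "fvs.dim U = m"
      using W finite_subset by (auto simp: Gras_def)
    show "card (adapted_lists (\<lambda>_. U) m) = ?P"
      using card_adapted_lists_const[OF U'(2,1)] card_subspace[OF U'(1,2)] U'(3) by simp
  qed
  finally show ?thesis using pos by simp
qed

text \<open>Extend \<open>A\<close> and its image under \<open>T\<close> to a basis of U. The image
  is computed from \<open>A\<close>, so t vectors for \<open>A\<close> and m - 2 t further ones name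
  U; the map from lists to subspaces only has to be surjective.\<close>

lemma card_subspaces_with_pairs_le:
  fixes W :: "('b \<Rightarrow> 'a::{field, finite}) set"
  assumes W: "finite W" and t: "2 * t \<le> m"
  shows "card {U \<in> Gras W m. T ` U \<subseteq> U \<and>
      (\<exists>A\<subseteq>U. card A = t \<and> fvs.independent (A \<union> T ` A) \<and> card (A \<union> T ` A) = 2 * t)}
    \<le> card W ^ (m - t)" (is "card ?G \<le> _")
proof -
  let ?L = "\<lambda>k. {xs. set xs \<subseteq> W \<and> length xs = k}"
  let ?g = "\<lambda>(xs, ys). fvs.span (set xs \<union> T ` set xs \<union> set ys)"
  have "?G \<subseteq> ?g ` (?L t \<times> ?L (m - 2 * t))"
  proof
    fix U assume "U \<in> ?G"
    then obtain A where U: "fvs.subspace U" "U \<subseteq> W" "fvs.dim U = m" "T ` U \<subseteq> U"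
      and A: "A \<subseteq> U" "card A = t" "fvs.independent (A \<union> T ` A)" "card (A \<union> T ` A) = 2 * t"
      by (auto simp: Gras_def)
    have fU: "finite U" using U W finite_subset by blast
    have "A \<union> T ` A \<subseteq> U" using A U by blast
    then obtain B where B: "A \<union> T ` A \<subseteq> B" "B \<subseteq> U" "fvs.independent B" "fvs.span B = U" "finite B"
      using subspace_basis[OF U(1) fU _ A(3)] by metis
    have "card B = m" using B U(3) fvs.dim_span_eq_card_independent by metis
    then have "card (B - (A \<union> T ` A)) = m - 2 * t"
      using B A by (metis card_Diff_subset finite_subset)
    moreover have "finite A" using A fU finite_subset by blast
    ultimately obtain xs ys where "set xs = A" "length xs = t" "set ys = B - (A \<union> T ` A)"
      "length ys = m - 2 * t"
      using A B finite_distinct_list distinct_card by (metis finite_Diff)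
    moreover from this have "set xs \<union> T ` set xs \<union> set ys = B" using B by blast
    ultimately show "U \<in> ?g ` (?L t \<times> ?L (m - 2 * t))"
      using B U A by (intro image_eqI[of _ _ "(xs, ys)"]) auto
  qed
  then have "card ?G \<le> card (?g ` (?L t \<times> ?L (m - 2 * t)))"
    using W by (intro card_mono) (auto simp: finite_lists_length_eq)
  also have "\<dots> \<le> card (?L t \<times> ?L (m - 2 * t))"
    using W by (intro card_image_le) (auto simp: finite_lists_length_eq)
  also have "\<dots> = card W ^ (t + (m - 2 * t))"
    using W by (simp add: card_cartesian_product card_lists_length_eq power_add)
  also have "t + (m - 2 * t) = m - t" using t by simp
  finally show ?thesis .
qed

text \<open>Outside the first kind, T - c maps U into the span of few vectors, so its image has at
  most q^(2 t) elements and its kernel on U, the intersection with an eigenspace, at least q^(m - 2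
  t). The scalar c varies with U, hence the sum over all c.\<close>

lemma card_invariant_subspaces_le:
  fixes W :: "('b \<Rightarrow> 'a::{field, finite}) set"
  assumes lin: "Vector_Spaces.linear fscale fscale T"
    and W: "finite W" "fvs.subspace W" and t: "2 * t \<le> m"
  shows "card {U \<in> Gras W m. T ` U \<subseteq> U} \<le> card W ^ (m - t)
    + (\<Sum>c\<in>UNIV. card {U \<in> Gras W m. CARD('a) ^ (m - 2 * t) \<le> card (U \<inter> {x \<in> W. T x = fscale c x})})"
    (is "card ?F \<le> _ + (\<Sum>c\<in>UNIV. card (?H c))")
proof -
  interpret T: Vector_Spaces.linear fscale fscale T by (rule lin)
  let ?G = "{U \<in> Gras W m. T ` U \<subseteq> U \<and>
      (\<exists>A\<subseteq>U. card A = t \<and> fvs.independent (A \<union> T ` A) \<and> card (A \<union> T ` A) = 2 * t)}"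
  have fin: "finite {U \<in> Gras W m. P U}" for P using finite_Gras[OF W(1)] by simp
  have "?F \<subseteq> ?G \<union> (\<Union>c. ?H c)"
  proof
    fix U assume "U \<in> ?F"
    then have U: "U \<in> Gras W m" "T ` U \<subseteq> U" "fvs.subspace U" "U \<subseteq> W" "fvs.dim U = m"
      by (auto simp: Gras_def)
    have fU: "finite U" using U W finite_subset by blast
    show "U \<in> ?G \<union> (\<Union>c. ?H c)"
    proof (cases "U \<in> ?G")
      case False
      then obtain c X where X: "X \<subseteq> U" "card X \<le> 2 * (t - 1)" "\<forall>u\<in>U. T u - fscale c u \<in> fvs.span X"
        using independent_pairs_or_near_scalar[OF lin U(3) fU U(2), of t] t U by auto
      have fX: "finite X" using X fU finite_subset by blast
      let ?f = "\<lambda>u. T u - fscale c u"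
      have "card (?f ` U) \<le> card (fvs.span X)"
        using X fX by (intro card_mono) (auto simp: finite_span)
      also have "\<dots> \<le> CARD('a) ^ card X" using card_span_le[OF fX] by simp
      also have "\<dots> \<le> CARD('a) ^ (2 * t)" using X card_field_gt_1[where 'a = 'a]
        by (intro power_increasing) auto
      finally have im: "card (?f ` U) \<le> CARD('a) ^ (2 * t)" .
      have k: "{x \<in> U. ?f x = 0} = U \<inter> {x \<in> W. T x = fscale c x}" using U by auto
      have "CARD('a) ^ (m - 2 * t) * CARD('a) ^ (2 * t) = card U"
        using card_subspace[OF U(3) fU] U t by (simp flip: power_add)
      also have "\<dots> \<le> card {x \<in> U. ?f x = 0} * card (?f ` U)"
        by (rule card_le_kernel_image)
          (auto simp: T.diff fvs.scale_right_diff_distrib fU U(3) fvs.subspace_diff)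
      also have "\<dots> \<le> card {x \<in> U. ?f x = 0} * CARD('a) ^ (2 * t)" using im by simp
      finally have "CARD('a) ^ (m - 2 * t) \<le> card (U \<inter> {x \<in> W. T x = fscale c x})"
        unfolding k by simp
      then show ?thesis using U by blast
    qed simp
  qed
  then have "card ?F \<le> card (?G \<union> (\<Union>c. ?H c))"
    by (intro card_mono) (auto simp: fin)
  also have "\<dots> \<le> card ?G + card (\<Union>c. ?H c)" by (rule card_Un_le)
  also have "card (\<Union>c. ?H c) \<le> (\<Sum>c\<in>UNIV. card (?H c))" by (rule card_UN_le) simp
  also have "card ?G \<le> card W ^ (m - t)" by (rule card_subspaces_with_pairs_le[OF W(1) t])
  finally show ?thesis by simp
qed

section \<open>Eigenspaces on the square\<close>

text \<open>Covers the square (via \<open>sq_index\<close>) and V itself (via \<open>{..<n}\<close>)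
  at once, so that cardinality and dimension are computed a single time.\<close>

definition supported :: "'b set \<Rightarrow> ('b \<Rightarrow> 'a::field) set" where
  "supported I = {f. \<forall>p. p \<notin> I \<longrightarrow> f p = 0}"

lemma sq_space_supported: "sq_space b n = supported (sq_index b n)"
  by (simp add: sq_space_def supported_def)

lemma subspace_supported: "fvs.subspace (supported I)"
  by (rule fvs.subspaceI) (auto simp: supported_def fscale_def)

lemma supported_card:
  assumes "finite I"
  shows "finite (supported I :: ('b \<Rightarrow> 'a::{field, finite}) set)"
    and "card (supported I :: ('b \<Rightarrow> 'a) set) = CARD('a) ^ card I"
proof -
  have "bij_betw (\<lambda>f. restrict f I) (supported I :: ('b \<Rightarrow> 'a) set) (I \<rightarrow>\<^sub>E UNIV)"
    by (rule bij_betwI[of _ _ _ "\<lambda>f p. if p \<in> I then f p else 0"])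
      (auto simp: supported_def fun_eq_iff PiE_def extensional_def)
  moreover have "finite (I \<rightarrow>\<^sub>E (UNIV :: 'a set))" "card (I \<rightarrow>\<^sub>E (UNIV :: 'a set)) = CARD('a) ^ card I"
    using assms by (auto intro: finite_PiE simp: card_funcsetE)
  ultimately show "finite (supported I :: ('b \<Rightarrow> 'a) set)"
    "card (supported I :: ('b \<Rightarrow> 'a) set) = CARD('a) ^ card I"
    by (auto dest: bij_betw_finite bij_betw_same_card)
qed

lemma dim_supported:
  assumes "finite I"
  shows "fvs.dim (supported I :: ('b \<Rightarrow> 'a::{field, finite}) set) = card I"
proof -
  have "CARD('a) ^ fvs.dim (supported I :: ('b \<Rightarrow> 'a) set) = CARD('a) ^ card I"
    using card_subspace[OF subspace_supported supported_card(1)[OF assms]] supported_card(2)[OF assms]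
    by metis
  then show ?thesis using card_field_gt_1[where 'a = 'a] by (simp add: power_inject_exp)
qed

lemmas finite_sq_space = supported_card(1)[OF finite_sq_index, folded sq_space_supported]
  and card_sq_space = supported_card(2)[OF finite_sq_index, folded sq_space_supported]
  and dim_sq_space = dim_supported[OF finite_sq_index, folded sq_space_supported]

section \<open>Coordinates for V and contractions of its square\<close>

text \<open>Span and independence are available for functions under \<open>fscale\<close>.
  Transporting \<open>carrier_vec n\<close> to functions lets the pair dichotomy be applied to V in
  the same form as to U.\<close>

abbreviation Vfun :: "nat \<Rightarrow> (nat \<Rightarrow> 'a::field) set" where
  "Vfun n \<equiv> supported {..<n}"

definition vfun :: "nat \<Rightarrow> 'a::field vec \<Rightarrow> nat \<Rightarrow> 'a" where
  "vfun n v = (\<lambda>i. if i < n then v $ i else 0)"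

definition mact :: "nat \<Rightarrow> 'a::field mat \<Rightarrow> (nat \<Rightarrow> 'a) \<Rightarrow> nat \<Rightarrow> 'a" where
  "mact n P f = vfun n (P *\<^sub>v vec n f)"

lemma vfun_in: "vfun n v \<in> Vfun n"
  by (auto simp: vfun_def supported_def)

lemma vfun_vec: "f \<in> Vfun n \<Longrightarrow> vfun n (vec n f) = f"
  by (auto simp: vfun_def supported_def)

lemma vec_vfun: "v \<in> carrier_vec n \<Longrightarrow> vec n (vfun n v) = v"
  by (auto simp: vfun_def)

lemma vfun_add: "u \<in> carrier_vec n \<Longrightarrow> v \<in> carrier_vec n \<Longrightarrow> vfun n (u + v) = vfun n u + vfun n v"
  by (auto simp: vfun_def)

lemma vfun_smult: "v \<in> carrier_vec n \<Longrightarrow> vfun n (c \<cdot>\<^sub>v v) = fscale c (vfun n v)"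
  by (auto simp: vfun_def fscale_def)

lemma mact_in: "mact n P f \<in> Vfun n"
  by (simp add: mact_def vfun_in)

lemma vec_plus: "vec n (f + g) = vec n f + vec n g"
  by (auto simp: plus_fun_def)

lemma vec_fscale: "vec n (fscale c f) = c \<cdot>\<^sub>v vec n f"
  by (auto simp: fscale_def)

lemma mact_linear:
  assumes P: "P \<in> carrier_mat n n"
  shows "Vector_Spaces.linear fscale fscale (mact n P)"
proof unfold_locales
  fix f g :: "nat \<Rightarrow> 'a" and c
  have "P *\<^sub>v (vec n f + vec n g) = P *\<^sub>v vec n f + P *\<^sub>v vec n g"
    by (rule mult_add_distrib_mat_vec[OF P]) auto
  then show "mact n P (f + g) = mact n P f + mact n P g"
    using P by (simp add: mact_def vec_plus vfun_add)
  have "P *\<^sub>v (c \<cdot>\<^sub>v vec n f) = c \<cdot>\<^sub>v (P *\<^sub>v vec n f)"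
    by (rule mult_mat_vec[OF P]) auto
  then show "mact n P (fscale c f) = fscale c (mact n P f)"
    using P by (simp add: mact_def vec_fscale vfun_smult)
qed

lemma mact_mult:
  assumes "P \<in> carrier_mat n n" "Q \<in> carrier_mat n n"
  shows "mact n (P * Q) f = mact n P (mact n Q f)"
  using assms by (simp add: mact_def vec_vfun assoc_mult_mat_vec[of _ n n _ n])

lemma mact_one: "f \<in> Vfun n \<Longrightarrow> mact n (1\<^sub>m n) f = f"
  by (simp add: mact_def vfun_vec)

definition sq_fun :: "square \<Rightarrow> nat \<Rightarrow> (nat \<Rightarrow> 'a::field) \<Rightarrow> (nat \<Rightarrow> 'a) \<Rightarrow> nat \<times> nat \<Rightarrow> 'a" where
  "sq_fun b n f g = sq_prod b n (vec n f) (vec n g)"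

lemma sq_act_sq_fun:
  assumes P: "P \<in> carrier_mat n n"
  shows "sq_act b n P (sq_fun b n f g) = sq_fun b n (mact n P f) (mact n P g)"
  using P by (simp add: sq_fun_def sq_act_prod mact_def vec_vfun)

lemma linear_sq_act: "Vector_Spaces.linear fscale fscale (sq_act b n P)"
  by unfold_locales (simp_all add: sq_act_def case_prod_unfold fvs.scale_left_distrib sum.distrib
    fvs.scale_sum_right fscale_apply)

text \<open>The universal property applied to the bilinear map (v, w) \<mapsto> \<phi>(v) w + e
  \<phi>(w) v. Taking e = 0, 1 or -1 makes it bilinear, symmetric or alternating as the square
  demands, in characteristic 2 as well.\<close>

lemma contraction:
  fixes \<phi> :: "(nat \<Rightarrow> 'a::field) \<Rightarrow> 'a"
  assumes add: "\<And>f g. \<phi> (f + g) = \<phi> f + \<phi> g" and scale: "\<And>c f. \<phi> (fscale c f) = c * \<phi> f"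
  obtains \<iota> e where "Vector_Spaces.linear fscale fscale \<iota>"
    "\<And>f g. f \<in> Vfun n \<Longrightarrow> g \<in> Vfun n \<Longrightarrow>
      \<iota> (sq_fun b n f g) = fscale (\<phi> f) g + fscale (e * \<phi> g) f"
proof -
  define e :: 'a where "e = (case b of Tensor \<Rightarrow> 0 | Symmetric \<Rightarrow> 1 | Exterior \<Rightarrow> - 1)"
  define B where "B v w = fscale (\<phi> (vfun n v)) (vfun n w) + fscale (e * \<phi> (vfun n w)) (vfun n v)"
    for v w
  define \<iota> where "\<iota> x = (\<Sum>(i, j)\<in>sq_index b n. fscale (x (i, j)) (B (unit_vec n i) (unit_vec n j)))" for x
  have bil: "bilin n fscale B"
    unfolding bilin_def
    by (simp add: B_def vfun_add vfun_smult add scale fvs.scale_right_distrib fvs.scale_left_distrib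
        distrib_left mult_ac add_ac del: plus_fun_def)
  have kind: "sq_kind b n B"
    by (cases b) (auto simp: B_def e_def fscale_def fun_eq_iff algebra_simps)
  have "Vector_Spaces.linear fscale fscale \<iota>"
    by unfold_locales (simp_all add: \<iota>_def case_prod_unfold fvs.scale_left_distrib sum.distrib
      fvs.scale_sum_right fscale_apply)
  moreover have "\<iota> (sq_fun b n f g) = fscale (\<phi> f) g + fscale (e * \<phi> g) f"
    if "f \<in> Vfun n" "g \<in> Vfun n" for f g
    unfolding \<iota>_def sq_fun_def
    by (subst kind_expand[OF vector_space_fscale bil kind]) (use that in \<open>auto simp: B_def vfun_vec\<close>)
  ultimately show ?thesis using that by blast
qed

lemma dual_functional:
  fixes B :: "('b \<Rightarrow> 'a::field) set"
  assumes "fvs.independent B"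
  obtains \<phi> where "\<And>f g. \<phi> (f + g) = \<phi> f + \<phi> g" "\<And>c f. \<phi> (fscale c f) = c * \<phi> f"
    "\<And>x. x \<in> B \<Longrightarrow> \<phi> x = (if x = z then 1 else (0 :: 'a))"
proof -
  interpret F: vector_space "(*) :: 'a \<Rightarrow> 'a \<Rightarrow> 'a"
    by unfold_locales (auto simp: algebra_simps)
  interpret vector_space_pair "fscale :: 'a \<Rightarrow> ('b \<Rightarrow> 'a) \<Rightarrow> 'b \<Rightarrow> 'a" "(*) :: 'a \<Rightarrow> 'a \<Rightarrow> 'a" ..
  obtain \<phi> where \<phi>: "Vector_Spaces.linear fscale (*) \<phi>" "\<forall>x\<in>B. \<phi> x = (if x = z then 1 else 0)"
    using linear_independent_extend[OF assms, of "\<lambda>x. if x = z then 1 else 0"] by blast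
  interpret L: Vector_Spaces.linear fscale "(*)" \<phi> by (rule \<phi>(1))
  show ?thesis using that[of \<phi>] \<phi>(2) by (simp add: L.add L.scale)
qed

text \<open>
  Contracting \<open>\<Sum>\<^sub>a (T - \<mu>) (a \<box> P\<^sup>-\<^sup>1 y\<^sub>a)\<close> with the functional dual to \<open>P a\<close> recovers \<open>y\<^sub>a\<close> modulo
  the span \<open>Z\<close> of all \<open>a\<close> and \<open>P a\<close>, so the image of \<open>T - \<mu>\<close> has dimension at least
  \<open>k (n - 2 k)\<close>.
\<close>

lemma card_sq_eigenspace_le:
  fixes P :: "'a::{field, finite} mat"
  assumes P: "P \<in> carrier (GL TYPE('a) n)"
    and A: "A \<subseteq> Vfun n" "card A = k" "fvs.independent (A \<union> mact n P ` A)"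
      "card (A \<union> mact n P ` A) = 2 * k"
  shows "card {x \<in> sq_space b n. sq_act b n P x = fscale \<mu> x} * CARD('a) ^ (k * (n - 2 * k))
    \<le> CARD('a) ^ card (sq_index b n)"
proof -
  let ?q = "CARD('a)" and ?W = "sq_space b n :: (nat \<times> nat \<Rightarrow> 'a) set"
  from P obtain Q where PQ: "P \<in> carrier_mat n n" "Q \<in> carrier_mat n n" "P * Q = 1\<^sub>m n"
    by (auto simp: carrier_GL)
  define p where "p = mact n P"
  define r where "r = mact n Q"
  define f where "f x = sq_act b n P x - fscale \<mu> x" for x
  interpret T: Vector_Spaces.linear fscale fscale "sq_act b n P" by (rule linear_sq_act)
  have pr: "p (r y) = y" if "y \<in> Vfun n" for y
    using that PQ by (simp add: p_def r_def mact_one flip: mact_mult)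
  have fadd: "f (x + y) = f x + f y" for x y
    by (simp add: f_def T.add fvs.scale_right_distrib)
  have f0: "f 0 = 0" by (simp add: f_def T.zero)
  have fsum: "f (\<Sum>a\<in>A. h a) = (\<Sum>a\<in>A. f (h a))" for h
    by (induction A rule: infinite_finite_induct)
      (simp_all only: sum.infinite sum.empty sum.insert fadd f0 simp_thms)
  define Z where "Z = fvs.span (A \<union> p ` A)"
  have fA: "finite A" using A(1) supported_card(1)[of "{..<n}"] finite_subset by blast
  \<comment> \<open>The full count 2 k is attained only if \<open>p\<close> is injective on
    \<open>A\<close> and the two halves are disjoint. Both facts are needed to evaluate the dual
    functional on each a and p a.\<close>
  have p_inj: "inj_on p A" and disj: "A \<inter> p ` A = {}"
  proof -
    have c: "card A + card (p ` A) = card (A \<union> p ` A) + card (A \<inter> p ` A)"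
      using fA by (intro card_Un_Int) auto
    have l: "card (p ` A) \<le> k" using card_image_le[OF fA, of p] A(2) by simp
    have "card (p ` A) = card A" "card (A \<inter> p ` A) = 0"
      using c l A(2,4) by (simp_all add: p_def)
    then show "inj_on p A" "A \<inter> p ` A = {}" using fA by (auto simp: inj_on_iff_eq_card)
  qed
  have AV: "A \<union> p ` A \<subseteq> Vfun n" using A(1) mact_in by (auto simp: p_def)
  have "card (A \<union> p ` A) \<le> card {..<n}"
  proof -
    obtain B where B: "A \<union> p ` A \<subseteq> B" "fvs.independent B" "fvs.span B = Vfun n" "finite B"
      using subspace_basis[OF subspace_supported supported_card(1) AV] A(3)
      by (metis finite_lessThan p_def)
    then have "card B = n"
      using fvs.dim_span_eq_card_independent[OF B(2)] by (simp add: dim_supported)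
    then show ?thesis using B card_mono by fastforce
  qed
  then have kn: "2 * k \<le> n" using A(4) by (simp add: p_def)
  have cZ: "card Z = ?q ^ (2 * k)" "finite Z"
    using card_span_independent[of "A \<union> p ` A"] A fA finite_span[of "A \<union> p ` A"]
    by (auto simp: Z_def p_def)
  \<comment> \<open>Recovery works only modulo \<open>Z\<close>. Restricting every y_a to pairwise
    incongruent vectors makes it exact and leaves at least q^(n - 2 k) choices for each a.\<close>
  obtain Y where Y: "Y \<subseteq> Vfun n" "\<And>x y. x \<in> Y \<Longrightarrow> y \<in> Y \<Longrightarrow> x - y \<in> Z \<Longrightarrow> x = y"
    "card (Vfun n :: (nat \<Rightarrow> 'a) set) \<le> card Y * card Z"
    using exists_transversal[of "Vfun n" Z] cZ supported_card(1)[of "{..<n}"]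
    by (metis Z_def empty_iff finite_lessThan fvs.span_diff fvs.span_zero)
  have "?q ^ (n - 2 * k) * ?q ^ (2 * k) \<le> card Y * ?q ^ (2 * k)"
    using Y(3) kn by (simp add: supported_card cZ flip: power_add)
  then have cY: "?q ^ (n - 2 * k) \<le> card Y" by simp
  define \<Phi> where "\<Phi> y = (\<Sum>a\<in>A. f (sq_fun b n a (r (y a))))" for y
  have inj: "inj_on \<Phi> (A \<rightarrow>\<^sub>E Y)"
  proof (rule inj_onI)
    fix y y' assume y: "y \<in> A \<rightarrow>\<^sub>E Y" "y' \<in> A \<rightarrow>\<^sub>E Y" and eq: "\<Phi> y = \<Phi> y'"
    have "y a0 = y' a0" if a0: "a0 \<in> A" for a0
    proof -
      obtain \<phi> where \<phi>: "\<And>f g. \<phi> (f + g) = \<phi> f + \<phi> g" "\<And>c f. \<phi> (fscale c f) = c * \<phi> f"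
        "\<And>x. x \<in> A \<union> p ` A \<Longrightarrow> \<phi> x = (if x = p a0 then 1 else 0)"
        using dual_functional[of "A \<union> p ` A" "p a0"] A(3) by (metis p_def)
      obtain \<iota> e where \<iota>: "Vector_Spaces.linear fscale fscale \<iota>"
        "\<And>f g. f \<in> Vfun n \<Longrightarrow> g \<in> Vfun n \<Longrightarrow>
          \<iota> (sq_fun b n f g) = fscale (\<phi> f) g + fscale (e * \<phi> g) f"
        using contraction[OF \<phi>(1,2)] by metis
      interpret I: Vector_Spaces.linear fscale fscale \<iota> by (rule \<iota>(1))
      have key: "\<iota> (\<Phi> y) - y a0 \<in> Z" if y: "y \<in> A \<rightarrow>\<^sub>E Y" for y
      proof -
        \<comment> \<open>What remains after removing the wanted vector is a combination of p a and
          a, whatever the value of \<open>e\<close>; this is why the three squares need no separate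
          treatment.\<close>
        have summand: "\<iota> (f (sq_fun b n a (r (y a)))) - (if a = a0 then y a else 0) \<in> Z"
          if a: "a \<in> A" for a
        proof -
          have ya: "y a \<in> Vfun n" using y a Y(1) by auto
          have aV: "a \<in> Vfun n" "p a \<in> Vfun n" "r (y a) \<in> Vfun n"
            using a A(1) mact_in by (auto simp: p_def r_def)
          have "\<phi> a = 0" using \<phi>(3)[of a] a a0 disj by auto
          moreover have "\<phi> (p a) = (if a = a0 then 1 else 0)"
            using \<phi>(3)[of "p a"] a a0 p_inj by (auto simp: inj_on_def)
          moreover have "f (sq_fun b n a (r (y a)))
              = sq_fun b n (p a) (y a) - fscale \<mu> (sq_fun b n a (r (y a)))"
            using sq_act_sq_fun[OF PQ(1), of b a "r (y a)"] pr[OF ya] by (simp add: f_def p_def)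
          ultimately have "\<iota> (f (sq_fun b n a (r (y a)))) - (if a = a0 then y a else 0)
              = fscale (e * \<phi> (y a)) (p a) - fscale \<mu> (fscale (e * \<phi> (r (y a))) a)"
            by (simp add: I.diff I.scale \<iota>(2) aV ya)
          also have "\<dots> \<in> Z" unfolding Z_def
            using a by (intro fvs.span_diff fvs.span_scale fvs.span_base) auto
          finally show ?thesis .
        qed
        have "(\<Sum>a\<in>A. if a = a0 then y a else 0) = y a0"
          using fA a0 by (simp add: sum.delta)
        then have "\<iota> (\<Phi> y) - y a0
            = (\<Sum>a\<in>A. \<iota> (f (sq_fun b n a (r (y a)))) - (if a = a0 then y a else 0))"
          unfolding \<Phi>_def by (simp only: I.sum sum_subtractf)
        also have "\<dots> \<in> Z" unfolding Z_def
          by (rule fvs.span_sum) (use summand Z_def in blast)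
        finally show ?thesis .
      qed
      have "(\<iota> (\<Phi> y') - y' a0) - (\<iota> (\<Phi> y) - y a0) \<in> Z"
        using key[OF y(1)] key[OF y(2)] unfolding Z_def by (meson fvs.span_diff)
      then have "y a0 - y' a0 \<in> Z" using eq by simp
      then show ?thesis using Y(2) y a0 by auto
    qed
    then show "y = y'" using y by (intro PiE_ext) auto
  qed
  have "\<Phi> y \<in> f ` ?W" for y
    unfolding \<Phi>_def fsum[symmetric]
    by (intro imageI fvs.subspace_sum subspace_sq_space) (simp add: sq_fun_def sq_prod_in)
  then have "card (A \<rightarrow>\<^sub>E Y) \<le> card (f ` ?W)"
    using finite_sq_space[of b n] by (intro card_inj_on_le[OF inj]) auto
  then have "card Y ^ k \<le> card (f ` ?W)" using fA A(2) by (simp add: card_funcsetE)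
  moreover have "?q ^ (k * (n - 2 * k)) \<le> card Y ^ k"
    using power_mono[OF cY, of k] by (simp add: mult.commute flip: power_mult)
  ultimately have im: "?q ^ (k * (n - 2 * k)) \<le> card (f ` ?W)" by simp
  have "card {x \<in> ?W. f x = 0} * card (f ` ?W) \<le> card ?W"
    by (rule card_kernel_image_le)
      (auto simp: fadd finite_sq_space fvs.subspace_add[OF subspace_sq_space])
  then have "card {x \<in> ?W. f x = 0} * ?q ^ (k * (n - 2 * k)) \<le> card ?W"
    using im by (meson le_trans mult_le_mono2)
  then show ?thesis by (simp add: f_def card_sq_space)
qed

section \<open>Matrices that are scalar modulo few vectors\<close>

definition near_scalar :: "'a::field itself \<Rightarrow> nat \<Rightarrow> nat \<Rightarrow> 'a mat set" where
  "near_scalar ty n k = {P \<in> carrier_mat n n. \<exists>c. \<exists>X\<subseteq>Vfun n. card X \<le> 2 * (k - 1) \<and>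
    (\<forall>u\<in>Vfun n. mact n P u - fscale c u \<in> fvs.span X)}"

lemma pairs_or_near_scalar:
  fixes P :: "'a::{field, finite} mat"
  assumes P: "P \<in> carrier_mat n n" and k: "2 * k \<le> n" and not: "P \<notin> near_scalar TYPE('a) n k"
  obtains A where "A \<subseteq> Vfun n" "card A = k" "fvs.independent (A \<union> mact n P ` A)"
    "card (A \<union> mact n P ` A) = 2 * k"
proof -
  have dim: "fvs.dim (Vfun n :: (nat \<Rightarrow> 'a) set) = n" by (simp add: dim_supported)
  have img: "mact n P ` Vfun n \<subseteq> Vfun n" using mact_in by blast
  have "\<not> (\<exists>c. \<exists>X\<subseteq>Vfun n. card X \<le> 2 * (k - 1) \<and>
      (\<forall>u\<in>Vfun n. mact n P u - fscale c u \<in> fvs.span X))"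
    using not P unfolding near_scalar_def by blast
  moreover note independent_pairs_or_near_scalar[OF mact_linear[OF P] subspace_supported
      supported_card(1)[OF finite_lessThan] img, of k, unfolded dim, OF k]
  ultimately have "\<exists>A\<subseteq>Vfun n. card A = k \<and> fvs.independent (A \<union> mact n P ` A) \<and>
      card (A \<union> mact n P ` A) = 2 * k"
    by argo
  then show ?thesis using that by blast
qed

abbreviation unitf :: "nat \<Rightarrow> nat \<Rightarrow> 'a::field" where
  "unitf j \<equiv> (\<lambda>i. if i = j then 1 else 0)"

lemma unitf_in: "j < n \<Longrightarrow> unitf j \<in> Vfun n"
  by (auto simp: supported_def)

lemma mact_unitf:
  fixes P :: "'a::field mat"
  assumes "P \<in> carrier_mat n n" "j < n" "i < n"
  shows "mact n P (unitf j) i = P $$ (i, j)"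
proof -
  have "vec n (unitf j) = (unit_vec n j :: 'a vec)" by (auto simp: unit_vec_def)
  then have "mact n P (unitf j) = vfun n (P *\<^sub>v unit_vec n j)" by (simp only: mact_def)
  then show ?thesis using assms by (simp add: vfun_def)
qed

text \<open>For k = 1 the set \<open>X\<close> is empty and P multiplies every vector by c, with c
  nonzero by invertibility. Consequently every nonscalar P admits at least one independent
  pair.\<close>

lemma near_scalar_1:
  fixes P :: "'a::{field, finite} mat"
  assumes P: "P \<in> carrier (GL TYPE('a) n)" "P \<in> near_scalar TYPE('a) n 1" and n: "0 < n"
  shows "P \<in> scalar_mats TYPE('a) n"
proof -
  from P obtain Q where PQ: "P \<in> carrier_mat n n" "Q \<in> carrier_mat n n" "P * Q = 1\<^sub>m n"
    by (auto simp: carrier_GL)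
  from P(2) obtain c and X :: "(nat \<Rightarrow> 'a) set"
    where X: "X \<subseteq> Vfun n" "card X \<le> 0" "\<forall>u\<in>Vfun n. mact n P u - fscale c u \<in> fvs.span X"
    by (auto simp: near_scalar_def)
  have "finite X" using X(1) supported_card(1)[of "{..<n}"] finite_subset by blast
  then have "X = {}" using X(2) by simp
  then have e: "mact n P u = fscale c u" if "u \<in> Vfun n" for u using X(3) that by simp
  have "P $$ (i, j) = (c \<cdot>\<^sub>m 1\<^sub>m n) $$ (i, j)" if "i < n" "j < n" for i j
    using mact_unitf[OF PQ(1) that(2,1)] e[OF unitf_in[OF that(2)]] that by (simp add: fscale_def)
  then have Pc: "P = c \<cdot>\<^sub>m 1\<^sub>m n" using PQ by (intro eq_matI) auto
  have "c \<noteq> 0"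
  proof
    assume "c = 0"
    then have "P = 0\<^sub>m n n" using Pc by auto
    then have "1\<^sub>m n = (0\<^sub>m n n :: 'a mat)" using PQ by simp
    then have "1\<^sub>m n $$ (0, 0) = (0\<^sub>m n n :: 'a mat) $$ (0, 0)" by simp
    then show False using n by simp
  qed
  then show ?thesis using Pc by (auto simp: scalar_mats_def)
qed

text \<open>P is determined by c, by vectors whose span contains that of \<open>X\<close>, and by
  the n differences P e_j - c e_j in this span. This gives q choices, then q^(2 k n) lists of 2 k
  vectors, then (q^(2 k))^n families of differences.\<close>

lemma card_near_scalar_le:
  "finite (near_scalar TYPE('a::{field, finite}) n k) \<and>
    card (near_scalar TYPE('a) n k) \<le> CARD('a) ^ (1 + 4 * k * n)"
proof -
  let ?q = "CARD('a)"
  define L where "L = {xs :: (nat \<Rightarrow> 'a) list. set xs \<subseteq> Vfun n \<and> length xs = 2 * k}"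
  define M where "M c xs = {P \<in> carrier_mat n n. \<forall>j<n. mact n P (unitf j) - fscale c (unitf j) \<in> fvs.span (set xs)}"
    for c :: 'a and xs
  have M: "finite (M c xs) \<and> card (M c xs) \<le> ?q ^ (2 * k * n)" if xs: "xs \<in> L" for c xs
  proof -
    let ?g = "\<lambda>P. \<lambda>j\<in>{..<n}. mact n P (unitf j) - fscale c (unitf j)"
    have "inj_on ?g (M c xs)"
    proof (rule inj_onI)
      fix P P' assume PP: "P \<in> M c xs" "P' \<in> M c xs" "?g P = ?g P'"
      have "P $$ (i, j) = P' $$ (i, j)" if "i < n" "j < n" for i j
      proof -
        have "mact n P (unitf j) = mact n P' (unitf j)"
          using fun_cong[OF PP(3), of j] that by simp
        moreover have "P \<in> carrier_mat n n" "P' \<in> carrier_mat n n" using PP(1,2) by (auto simp: M_def)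
        ultimately show ?thesis using mact_unitf[OF _ that(2,1)] by metis
      qed
      then show "P = P'" using PP(1,2) by (intro eq_matI) (auto simp: M_def)
    qed
    moreover have "?g ` M c xs \<subseteq> {..<n} \<rightarrow>\<^sub>E fvs.span (set xs)"
      by (auto simp: M_def)
    moreover have fin: "finite ({..<n} \<rightarrow>\<^sub>E fvs.span (set xs))"
      by (intro finite_PiE) (auto simp: finite_span)
    ultimately have "finite (M c xs)" "card (M c xs) \<le> card ({..<n} \<rightarrow>\<^sub>E fvs.span (set xs))"
      by (auto intro: inj_on_finite card_inj_on_le)
    moreover have "card (fvs.span (set xs)) \<le> ?q ^ (2 * k)"
    proof -
      have "card (fvs.span (set xs)) \<le> ?q ^ card (set xs)" using card_span_le[of "set xs"] by simp
      also have "\<dots> \<le> ?q ^ (2 * k)"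
        using card_length[of xs] xs card_field_gt_1[where 'a = 'a]
        by (intro power_increasing) (auto simp: L_def)
      finally show ?thesis .
    qed
    then have "card ({..<n} \<rightarrow>\<^sub>E fvs.span (set xs)) \<le> ?q ^ (2 * k * n)"
      using power_mono[of "card (fvs.span (set xs))" "?q ^ (2 * k)" n]
      by (simp add: card_funcsetE power_mult)
    ultimately show ?thesis by simp
  qed
  have fL: "finite L" and cL: "card L = ?q ^ (2 * k * n)"
    unfolding L_def using supported_card[of "{..<n}", where 'a = 'a]
    by (auto simp: finite_lists_length_eq card_lists_length_eq mult.commute simp flip: power_mult)
  have sub: "near_scalar TYPE('a) n k \<subseteq> (\<Union>c\<in>UNIV. \<Union>xs\<in>L. M c xs)"
  proof
    fix P assume "P \<in> near_scalar TYPE('a) n k"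
    then obtain c X where P: "P \<in> carrier_mat n n" and X: "X \<subseteq> Vfun n" "card X \<le> 2 * (k - 1)"
      "\<forall>u\<in>Vfun n. mact n P u - fscale c u \<in> fvs.span X"
      by (auto simp: near_scalar_def)
    have "finite X" using X(1) supported_card(1)[of "{..<n}"] finite_subset by blast
    then obtain ys where ys: "set ys = X" "length ys = card X"
      using finite_distinct_list distinct_card by metis
    \<comment> \<open>Zero vectors pad the list to length exactly 2 k without changing its
      span.\<close>
    define xs where "xs = ys @ replicate (2 * k - card X) 0"
    have "xs \<in> L" using ys X fvs.subspace_0[OF subspace_supported] by (auto simp: L_def xs_def)
    moreover have "fvs.span X \<subseteq> fvs.span (set xs)"
      using ys by (intro fvs.span_mono) (auto simp: xs_def)
    then have "P \<in> M c xs" using P X(3) unitf_in by (auto simp: M_def)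
    ultimately show "P \<in> (\<Union>c\<in>UNIV. \<Union>xs\<in>L. M c xs)" by blast
  qed
  have fin: "finite (\<Union>c\<in>UNIV. \<Union>xs\<in>L. M c xs)" using fL M by auto
  have "card (near_scalar TYPE('a) n k) \<le> card (\<Union>c\<in>UNIV. \<Union>xs\<in>L. M c xs)"
    by (rule card_mono[OF fin sub])
  also have "\<dots> \<le> (\<Sum>c\<in>UNIV. card (\<Union>xs\<in>L. M c xs))" by (rule card_UN_le) simp
  also have "\<dots> \<le> (\<Sum>c\<in>(UNIV::'a set). \<Sum>xs\<in>L. card (M c xs))"
    by (intro sum_mono card_UN_le fL)
  also have "\<dots> \<le> (\<Sum>c\<in>(UNIV::'a set). \<Sum>xs\<in>L. ?q ^ (2 * k * n))"
    using M by (intro sum_mono) auto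
  also have "\<dots> = ?q ^ (1 + 4 * k * n)"
    by (simp add: cL flip: power_add) (simp add: algebra_simps)
  finally show ?thesis using finite_subset[OF sub fin] by simp
qed

section \<open>Counting orbits\<close>

lemma real_le_powr_diff:
  fixes a q x y :: nat
  assumes "a * q ^ x \<le> q ^ y" "0 < q"
  shows "real a \<le> real q powr (real y - real x)"
proof -
  have "real a * real q ^ x \<le> real q ^ y" 
    using of_nat_mono[OF assms(1), where 'a = real] by simp
  then show ?thesis using assms(2) by (simp add: powr_diff powr_realpow field_simps)
qed

text \<open>In the second exponent, 1 accounts for the q possible eigenvalues and the extra m for
  the loss in counting bases. The saving is the number m - 2 t of basis vectors drawn from an
  eigenspace times its codimension bound k (n - 2 k), reduced by 2 t for the vectors chosen
  freely.\<close>

lemma card_fixed_Gr_le: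
  fixes P :: "'a::{field, finite} mat"
  defines "q \<equiv> real CARD('a)"
  assumes P: "P \<in> carrier (GL TYPE('a) n)"
    and pairs: "P \<notin> near_scalar TYPE('a) n k" "2 * k \<le> n" and t: "2 * t \<le> m"
  shows "real (card {U \<in> Gr b n m. sq_act b n P ` U = U})
    \<le> q powr (real (card (sq_index b n)) * (real m - real t))
    + q powr (1 + real m * (real (card (sq_index b n)) - real m) + real m
        - (real m - 2 * real t) * (real k * (real n - 2 * real k) - 2 * real t))"
proof -
  let ?q = "CARD('a)" and ?W = "sq_space b n :: (nat \<times> nat \<Rightarrow> 'a) set" and ?T = "sq_act b n P"
  define N where "N = card (sq_index b n)"
  define s where "s = 2 * t"
  define d where "d = k * (n - 2 * k)"
  define H where "H c = {U \<in> Gras ?W m. ?q ^ (m - s) \<le> card (U \<inter> {x \<in> ?W. ?T x = fscale c x})}" for c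
  have q: "1 < ?q" by (rule card_field_gt_1)
  have P': "P \<in> carrier_mat n n" using P by (simp add: carrier_GL)
  obtain A where A: "A \<subseteq> Vfun n" "card A = k" "fvs.independent (A \<union> mact n P ` A)"
    "card (A \<union> mact n P ` A) = 2 * k"
    using pairs_or_near_scalar[OF P' pairs(2,1)] .
  have H: "real (card (H c)) \<le> q powr (real m * (real N - real m) + real m
      - (real m - real s) * (real d - real s))" for c
  proof -
    let ?E = "{x \<in> ?W. ?T x = fscale c x}"
    let ?x = "(m - s) * (m - s - 1) + s * (m - 1)"
    have E: "card ?E * ?q ^ d \<le> ?q ^ N"
      using card_sq_eigenspace_le[OF P A] by (simp add: N_def d_def)
    have "card (H c) * ?q ^ (?x + d * (m - s)) = card (H c) * ?q ^ ?x * (?q ^ d) ^ (m - s)"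
      by (simp only: power_add power_mult mult.assoc)
    also have "\<dots> \<le> card ?E ^ (m - s) * card ?W ^ s * (?q ^ d) ^ (m - s)"
      using card_subspaces_meeting_le[of ?W ?E s m] t finite_sq_space
      by (intro mult_right_mono) (auto simp: H_def s_def)
    also have "\<dots> = (card ?E * ?q ^ d) ^ (m - s) * card ?W ^ s"
      by (simp add: power_mult_distrib)
    also have "\<dots> \<le> (?q ^ N) ^ (m - s) * (?q ^ N) ^ s"
      using power_mono[OF E] by (simp add: card_sq_space N_def)
    also have "\<dots> = ?q ^ (N * m)"
    proof -
      have "m - s + s = m" using t by (simp add: s_def)
      then show ?thesis by (metis power_add power_mult)
    qed
    finally have "real (card (H c)) \<le> q powr (real (N * m) - real (?x + d * (m - s)))"
      unfolding q_def using q by (intro real_le_powr_diff) auto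
    also have "real (N * m) - real (?x + d * (m - s))
        = real m * (real N - real m) + real m - (real m - real s) * (real d - real s)"
    proof -
      have "real ((m - s) * (m - s - 1)) = (real m - real s) * (real m - real s - 1)"
        using t by (cases "m = s") (auto simp: s_def of_nat_diff)
      moreover have "real (s * (m - 1)) = real s * (real m - 1)"
        using t by (cases m) (auto simp: s_def)
      moreover have "real (m - s) = real m - real s" using t by (simp add: s_def)
      ultimately show ?thesis
        unfolding of_nat_add of_nat_mult[of d] of_nat_mult[of N] by (simp add: algebra_simps)
    qed
    finally show ?thesis .
  qed
  have "{U \<in> Gr b n m. ?T ` U = U} \<subseteq> {U \<in> Gras ?W m. ?T ` U \<subseteq> U}"
    by (auto simp: Gr_def Gras_def)
  then have "card {U \<in> Gr b n m. ?T ` U = U} \<le> card {U \<in> Gras ?W m. ?T ` U \<subseteq> U}"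
    by (intro card_mono) (auto simp: finite_Gras finite_sq_space)
  also have "\<dots> \<le> card ?W ^ (m - t) + (\<Sum>c\<in>UNIV. card (H c))"
    unfolding H_def s_def
    by (rule card_invariant_subspaces_le[OF linear_sq_act finite_sq_space subspace_sq_space t])
  finally have "card {U \<in> Gr b n m. ?T ` U = U} \<le> card ?W ^ (m - t) + (\<Sum>c\<in>UNIV. card (H c))" .
  then have "real (card {U \<in> Gr b n m. ?T ` U = U})
      \<le> real (card ?W ^ (m - t)) + (\<Sum>c\<in>UNIV. real (card (H c)))"
    unfolding of_nat_add[symmetric] of_nat_sum[symmetric] by (rule of_nat_mono)
  also have "(\<Sum>c\<in>UNIV. real (card (H c))) \<le> (\<Sum>c\<in>(UNIV::'a set). q powr (real m * (real N - real m) + real m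
      - (real m - real s) * (real d - real s)))"
    by (intro sum_mono H)
  also have "\<dots> = q powr (1 + (real m * (real N - real m) + real m
      - (real m - real s) * (real d - real s)))"
    using q by (subst powr_add) (simp add: q_def)
  also have "real (card ?W ^ (m - t)) = q powr (real N * (real m - real t))"
  proof -
    have "real (card ?W ^ (m - t)) = q ^ (N * (m - t))"
      by (simp add: card_sq_space N_def q_def power_mult)
    also have "\<dots> = q powr real (N * (m - t))" using q by (subst powr_realpow) (auto simp: q_def)
    also have "real (N * (m - t)) = real N * (real m - real t)" using t by (simp add: of_nat_diff)
    finally show ?thesis .
  qed
  finally show ?thesis
    using pairs(2) by (simp add: N_def s_def d_def of_nat_diff add.assoc add_diff_eq)
qed

section \<open>Group orders and the sum over the group\<close>

lemma card_carrier_mat_le: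
  "finite (carrier_mat n n :: 'a::{field, finite} mat set) \<and>
    card (carrier_mat n n :: 'a mat set) \<le> CARD('a) ^ (n\<^sup>2)"
proof -
  let ?g = "\<lambda>A :: 'a mat. \<lambda>p\<in>{..<n} \<times> {..<n}. A $$ p"
  have "inj_on ?g (carrier_mat n n)"
  proof (rule inj_onI)
    fix A B :: "'a mat" assume AB: "A \<in> carrier_mat n n" "B \<in> carrier_mat n n" "?g A = ?g B"
    have "A $$ (i, j) = B $$ (i, j)" if "i < n" "j < n" for i j
      using fun_cong[OF AB(3), of "(i, j)"] that by simp
    then show "A = B" using AB by (intro eq_matI) auto
  qed
  moreover have "?g ` carrier_mat n n \<subseteq> {..<n} \<times> {..<n} \<rightarrow>\<^sub>E UNIV" by (auto split: if_splits)
  moreover have "finite ({..<n} \<times> {..<n} \<rightarrow>\<^sub>E (UNIV :: 'a set))" by (intro finite_PiE) auto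
  moreover have "card ({..<n} \<times> {..<n} \<rightarrow>\<^sub>E (UNIV :: 'a set)) = CARD('a) ^ (n\<^sup>2)"
    by (simp add: card_funcsetE card_cartesian_product power2_eq_square)
  ultimately show ?thesis by (metis card_inj_on_le inj_on_finite)
qed

lemma finite_GL: "finite (carrier (GL TYPE('a::{field, finite}) n))"
  by (rule finite_subset[OF _ card_carrier_mat_le[THEN conjunct1]]) (auto simp: carrier_GL)

lemma order_GL_bounds:
  "0 < order (GL TYPE('a::{field, finite}) n)" "order (GL TYPE('a) n) \<le> CARD('a) ^ (n\<^sup>2)"
proof -
  interpret G: group "GL TYPE('a) n" by (rule group_GL)
  show "0 < order (GL TYPE('a) n)" using G.order_gt_0_iff_finite finite_GL by blast
  have "card (carrier (GL TYPE('a) n)) \<le> card (carrier_mat n n :: 'a mat set)"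
    by (rule card_mono[OF card_carrier_mat_le[THEN conjunct1]]) (auto simp: carrier_GL)
  then show "order (GL TYPE('a) n) \<le> CARD('a) ^ (n\<^sup>2)"
    using card_carrier_mat_le[of n, where 'a = 'a] by (simp add: order_def)
qed

lemma card_scalar_mats:
  assumes "0 < n"
  shows "card (scalar_mats TYPE('a::{field, finite}) n) = CARD('a) - 1"
proof -
  have "scalar_mats TYPE('a) n = (\<lambda>c. c \<cdot>\<^sub>m 1\<^sub>m n) ` (UNIV - {0})"
    by (auto simp: scalar_mats_def)
  moreover have "inj_on (\<lambda>c :: 'a. c \<cdot>\<^sub>m 1\<^sub>m n) (UNIV - {0})"
  proof (rule inj_onI)
    fix c d :: 'a assume "c \<cdot>\<^sub>m 1\<^sub>m n = d \<cdot>\<^sub>m 1\<^sub>m n"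
    then have "(c \<cdot>\<^sub>m 1\<^sub>m n) $$ (0, 0) = (d \<cdot>\<^sub>m 1\<^sub>m n) $$ (0, 0)" by simp
    then show "c = d" using assms by simp
  qed
  ultimately show ?thesis by (simp add: card_image card_Diff_subset)
qed

lemma order_PGL:
  assumes "0 < n"
  shows "order (PGL TYPE('a::{field, finite}) n) * (CARD('a) - 1) = order (GL TYPE('a) n)"
proof -
  interpret G: group "GL TYPE('a) n" by (rule group_GL)
  have "subgroup (scalar_mats TYPE('a) n) (GL TYPE('a) n)"
    by (rule normal_imp_subgroup[OF scalar_mats_normal])
  then have "card (rcosets\<^bsub>GL TYPE('a) n\<^esub> scalar_mats TYPE('a) n) * card (scalar_mats TYPE('a) n)
      = order (GL TYPE('a) n)" by (rule G.lagrange)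
  then show ?thesis by (simp add: card_scalar_mats[OF assms] PGL_def FactGroup_def order_def)
qed

lemma num_orbits_le:
  fixes b :: square and n m :: nat and \<epsilon> :: real
  assumes n: "0 < n"
    and sum: "(\<Sum>P\<in>carrier (GL TYPE('a::{field, finite}) n) - scalar_mats TYPE('a) n.
        real (card {U \<in> Gr b n m. sq_act b n P ` U = U}))
      \<le> \<epsilon> * real (card (Gr b n m :: (nat \<times> nat \<Rightarrow> 'a) set set))"
    and \<epsilon>: "0 \<le> \<epsilon>"
  shows "real (num_orbits TYPE('a) b n m) \<le> (1 + \<epsilon>) *
    (real (card (Gr b n m :: (nat \<times> nat \<Rightarrow> 'a) set set)) / real (order (PGL TYPE('a) n)))"
proof -
  let ?G = "GL TYPE('a) n" and ?S = "scalar_mats TYPE('a) n"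
    and ?X = "Gr b n m :: (nat \<times> nat \<Rightarrow> 'a) set set"
  let ?F = "\<lambda>P. {U \<in> ?X. sq_act b n P ` U = U}"
  interpret group_action ?G ?X "Gr_act b n m" by (rule group_action_Gr)
  have q: "1 < CARD('a)" by (rule card_field_gt_1)
  have inv: "invariants ?X (Gr_act b n m) P = ?F P" for P
    by (auto simp: invariants_def Gr_act_def)
  have S: "?S \<subseteq> carrier ?G"
    by (rule subgroup.subset[OF normal_imp_subgroup[OF scalar_mats_normal]])
  have fS: "finite ?S" using S finite_GL finite_subset by blast
  have "real (num_orbits TYPE('a) b n m) * real (order ?G) = (\<Sum>P\<in>carrier ?G. real (card (?F P)))"
    unfolding num_orbits_def of_nat_mult[symmetric] of_nat_sum[symmetric]
    using burnside[OF finite_GL finite_Gr] by (simp only: inv)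
  also have "\<dots> = (\<Sum>P\<in>carrier ?G - ?S. real (card (?F P))) + (\<Sum>P\<in>?S. real (card (?F P)))"
    by (rule sum.subset_diff[OF S finite_GL])
  also have "(\<Sum>P\<in>?S. real (card (?F P))) \<le> (\<Sum>P\<in>?S. real (card ?X))"
    by (intro sum_mono) (auto intro!: card_mono simp: finite_Gr)
  also have "\<dots> = real (CARD('a) - 1) * real (card ?X)" using card_scalar_mats[OF n, where 'a = 'a] by simp
  also have "(\<Sum>P\<in>carrier ?G - ?S. real (card (?F P))) \<le> \<epsilon> * real (card ?X)" by (rule sum)
  \<comment> \<open>The factor q - 1 >= 1 is inserted so that both sums carry it; it then cancels
    against |GL| = |PGL| (q - 1).\<close>
  also have "\<epsilon> * real (card ?X) \<le> real (CARD('a) - 1) * (\<epsilon> * real (card ?X))"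
    using mult_right_mono[of 1 "real (CARD('a) - 1)" "\<epsilon> * real (card ?X)"] \<epsilon> q by simp
  finally have "real (num_orbits TYPE('a) b n m) * real (order ?G)
      \<le> (1 + \<epsilon>) * real (card ?X) * real (CARD('a) - 1)"
    by (simp add: algebra_simps)
  moreover have "real (order ?G) = real (order (PGL TYPE('a) n)) * real (CARD('a) - 1)"
    unfolding of_nat_mult[symmetric] by (simp only: order_PGL[OF n])
  ultimately have "real (num_orbits TYPE('a) b n m) * real (order (PGL TYPE('a) n)) * real (CARD('a) - 1)
      \<le> (1 + \<epsilon>) * real (card ?X) * real (CARD('a) - 1)"
    by (simp add: mult_ac)
  then have *: "real (num_orbits TYPE('a) b n m) * real (order (PGL TYPE('a) n)) \<le> (1 + \<epsilon>) * real (card ?X)"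
    using q by (subst (asm) mult_le_cancel_right_pos) auto
  have "0 < order (PGL TYPE('a) n)"
    using order_PGL[OF n, where 'a = 'a] order_GL_bounds(1)[of n, where 'a = 'a] by (auto intro: gr0I)
  then show ?thesis using * by (simp add: pos_le_divide_eq)
qed

text \<open>Separates the counting from the asymptotics: the assumptions are comparisons of
  exponents, one for U with many pairs and one for each of the two classes of P when U is close to
  an eigenspace. The first part of \<open>near\<close> lets \<open>many_generators\<close> serve
  both classes.\<close>

lemma sum_fixed_Gr_le:
  fixes b :: square and n m k t :: nat and c :: real
  defines "q \<equiv> real CARD('a::{field, finite})" and "N \<equiv> real (card (sq_index b n))"
  assumes n: "2 \<le> n" and k: "2 * k \<le> n" and t: "2 * t \<le> m" and mN: "m \<le> card (sq_index b n)"
    and many_generators: "(real n)\<^sup>2 + N * (real m - real t) \<le> real m * (N - real m) - c * (real n)\<^sup>2 - 2"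
    and generic: "(real n)\<^sup>2 + (1 + real m * (N - real m) + real m
        - (real m - 2 * real t) * (real k * (real n - 2 * real k) - 2 * real t))
      \<le> real m * (N - real m) - c * (real n)\<^sup>2 - 2"
    and near: "1 + 4 * real k * real n \<le> (real n)\<^sup>2"
      "1 + 4 * real k * real n + (1 + real m * (N - real m) + real m
        - (real m - 2 * real t) * (real n - 2 - 2 * real t))
      \<le> real m * (N - real m) - c * (real n)\<^sup>2 - 2"
  shows "(\<Sum>P\<in>carrier (GL TYPE('a) n) - scalar_mats TYPE('a) n.
        real (card {U \<in> Gr b n m. sq_act b n P ` U = U}))
      \<le> q powr (- c * (real n)\<^sup>2) * real (card (Gr b n m :: (nat \<times> nat \<Rightarrow> 'a) set set))"
proof -
  let ?G = "carrier (GL TYPE('a) n)" and ?S = "scalar_mats TYPE('a) n"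
    and ?Z = "near_scalar TYPE('a) n k"
  let ?f = "\<lambda>P. real (card {U \<in> Gr b n m. sq_act b n P ` U = U})"
  define g where "g = real m * (N - real m) - c * (real n)\<^sup>2"
  define X where "X = N * (real m - real t)"
  define Y where "Y k = 1 + real m * (N - real m) + real m
        - (real m - 2 * real t) * (real k * (real n - 2 * real k) - 2 * real t)" for k
  have q: "2 \<le> q" using card_field_gt_1[where 'a = 'a] by (simp add: q_def)
  \<comment> \<open>Two classes of P and two kinds of U give four products. The slack 2 in the
    exponents pays for a quarter each, because q^2 >= 4.\<close>
  have quarter: "q powr x * q powr y \<le> q powr g / 4" if "x + y \<le> g - 2" for x y
  proof -
    have "q powr x * q powr y \<le> q powr (g - 2)" using that q by (simp flip: powr_add)
    also have "\<dots> = q powr g / q\<^sup>2" using q by (simp add: powr_diff powr_numeral)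
    also have "\<dots> \<le> q powr g / 4"
      using q power_mono[of 2 q 2] by (intro divide_left_mono) auto
    finally show ?thesis .
  qed
  have fin: "finite (?G - ?S)" using finite_GL by blast
  have "(\<Sum>P\<in>?G - ?S - ?Z. ?f P) \<le> (\<Sum>P\<in>?G - ?S - ?Z. q powr X + q powr Y k)"
    unfolding X_def Y_def q_def N_def
    by (intro sum_mono card_fixed_Gr_le) (use k t in auto)
  also have "\<dots> = real (card (?G - ?S - ?Z)) * (q powr X + q powr Y k)" by simp
  also have "\<dots> \<le> q powr ((real n)\<^sup>2) * (q powr X + q powr Y k)"
  proof (rule mult_right_mono)
    have "card (?G - ?S - ?Z) \<le> card ?G" by (rule card_mono[OF finite_GL]) auto
    also have "\<dots> \<le> CARD('a) ^ (n\<^sup>2)" using order_GL_bounds(2)[of n, where 'a = 'a] by (simp add: order_def)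
    finally have "real (card (?G - ?S - ?Z)) \<le> q ^ (n\<^sup>2)"
      unfolding q_def of_nat_power[symmetric] by (rule of_nat_mono)
    also have "\<dots> = q powr ((real n)\<^sup>2)" using q by (subst powr_realpow[symmetric]) auto
    finally show "real (card (?G - ?S - ?Z)) \<le> q powr ((real n)\<^sup>2)" .
  qed simp
  also have "\<dots> \<le> q powr g / 4 + q powr g / 4"
    unfolding distrib_left using many_generators generic
    by (intro add_mono quarter) (auto simp: X_def Y_def g_def)
  finally have far: "(\<Sum>P\<in>?G - ?S - ?Z. ?f P) \<le> q powr g / 4 + q powr g / 4" .
  \<comment> \<open>Here P may have fewer than k pairs, but it is not scalar, so the bound for fixed
    subspaces applies with one pair.\<close>
  have "(\<Sum>P\<in>(?G - ?S) \<inter> ?Z. ?f P) \<le> (\<Sum>P\<in>(?G - ?S) \<inter> ?Z. q powr X + q powr Y 1)"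
    unfolding X_def Y_def q_def N_def
    by (intro sum_mono card_fixed_Gr_le) (use n t near_scalar_1[where 'a = 'a and n = n] in auto)
  also have "\<dots> = real (card ((?G - ?S) \<inter> ?Z)) * (q powr X + q powr Y 1)" by simp
  also have "\<dots> \<le> q powr (1 + 4 * real k * real n) * (q powr X + q powr Y 1)"
  proof (rule mult_right_mono)
    have "card ((?G - ?S) \<inter> ?Z) \<le> card ?Z" by (rule card_mono) (use card_near_scalar_le in auto)
    also have "\<dots> \<le> CARD('a) ^ (1 + 4 * k * n)" using card_near_scalar_le by blast
    finally have "real (card ((?G - ?S) \<inter> ?Z)) \<le> q ^ (1 + 4 * k * n)"
      unfolding q_def of_nat_power[symmetric] by (rule of_nat_mono)
    also have "\<dots> = q powr (1 + 4 * real k * real n)" using q by (subst powr_realpow[symmetric]) auto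
    finally show "real (card ((?G - ?S) \<inter> ?Z)) \<le> q powr (1 + 4 * real k * real n)" .
  qed simp
  also have "\<dots> \<le> q powr g / 4 + q powr g / 4"
    unfolding distrib_left using many_generators near
    by (intro add_mono quarter) (auto simp: X_def Y_def g_def)
  finally have close: "(\<Sum>P\<in>(?G - ?S) \<inter> ?Z. ?f P) \<le> q powr g / 4 + q powr g / 4" .
  have "(\<Sum>P\<in>?G - ?S. ?f P) = (\<Sum>P\<in>(?G - ?S) \<inter> ?Z. ?f P) + (\<Sum>P\<in>?G - ?S - ?Z. ?f P)"
    by (rule sum.Int_Diff[OF fin])
  also have "\<dots> \<le> q powr g" using far close by simp
  also have "\<dots> = q powr (- c * (real n)\<^sup>2) * q powr (real m * (N - real m))"
    by (simp add: g_def flip: powr_add)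
  also have "\<dots> \<le> q powr (- c * (real n)\<^sup>2) * real (card (Gr b n m :: (nat \<times> nat \<Rightarrow> 'a) set set))"
  proof (rule mult_left_mono)
    have "Gr b n m = Gras (sq_space b n :: (nat \<times> nat \<Rightarrow> 'a) set) m" by (simp add: Gr_def Gras_def)
    then have "CARD('a) ^ (m * (card (sq_index b n) - m)) \<le> card (Gr b n m :: (nat \<times> nat \<Rightarrow> 'a) set set)"
      using card_Gras_ge[OF finite_sq_space subspace_sq_space, of m b n, where 'a = 'a] mN
      by (simp add: dim_sq_space)
    then have "q ^ (m * (card (sq_index b n) - m)) \<le> real (card (Gr b n m :: (nat \<times> nat \<Rightarrow> 'a) set set))"
      unfolding q_def of_nat_power[symmetric] by (rule of_nat_mono)
    moreover have "q ^ (m * (card (sq_index b n) - m)) = q powr (real m * (N - real m))"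
      using q mN by (subst powr_realpow[symmetric]) (auto simp: N_def of_nat_diff)
    ultimately show "q powr (real m * (N - real m)) \<le> real (card (Gr b n m :: (nat \<times> nat \<Rightarrow> 'a) set set))"
      by simp
  qed simp
  finally show ?thesis .
qed

section \<open>Choice of constants and asymptotics\<close>

text \<open>The rectangle of pairs with i below n div 2 and j from n div 2 on satisfies i < j, so it
  lies in all three index sets. Its sides are at least n / 4 and n / 2.\<close>

lemma card_sq_index_ge:
  assumes "2 \<le> n"
  shows "(real n)\<^sup>2 / 8 \<le> real (card (sq_index b n))"
proof -
  let ?h = "n div 2"
  have "{..<?h} \<times> {?h..<n} \<subseteq> sq_index b n" by (cases b) auto
  then have "card ({..<?h} \<times> {?h..<n}) \<le> card (sq_index b n)"
    by (rule card_mono[OF finite_sq_index])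
  then have "?h * (n - ?h) \<le> card (sq_index b n)" by (simp add: card_cartesian_product)
  then have "real ?h * real (n - ?h) \<le> real (card (sq_index b n))"
    unfolding of_nat_mult[symmetric] by (rule of_nat_mono)
  moreover have "real n / 4 * (real n / 2) \<le> real ?h * real (n - ?h)"
    using assms by (intro mult_mono) linarith+
  ultimately show ?thesis by (simp add: power2_eq_square)
qed

lemma eventually_quadratic_nonpos:
  fixes u v w :: real
  assumes "u < 0"
  shows "\<forall>\<^sub>F n in sequentially. u * (real n)\<^sup>2 + v * real n + w \<le> 0"
proof (rule eventually_sequentiallyI)
  fix n assume n: "nat \<lceil>max 1 ((\<bar>v\<bar> + \<bar>w\<bar>) / (- u))\<rceil> \<le> n"
  then have x: "1 \<le> real n" "(\<bar>v\<bar> + \<bar>w\<bar>) / (- u) \<le> real n" by linarith+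
  have "v * real n + w \<le> \<bar>v\<bar> * real n + \<bar>w\<bar> * 1"
    using x by (intro add_mono mult_right_mono) auto
  also have "\<dots> \<le> \<bar>v\<bar> * real n + \<bar>w\<bar> * real n" using x by (intro add_mono mult_left_mono) auto
  also have "\<dots> = (\<bar>v\<bar> + \<bar>w\<bar>) * real n" by (simp add: algebra_simps)
  also have "\<dots> \<le> (real n * - u) * real n"
  proof (rule mult_right_mono)
    have "0 < - u" using assms by simp
    then show "\<bar>v\<bar> + \<bar>w\<bar> \<le> real n * - u" using x(2) by (simp only: pos_divide_le_eq)
  qed simp
  finally show "u * (real n)\<^sup>2 + v * real n + w \<le> 0" by (simp add: power2_eq_square algebra_simps)
qed

theorem theorem3p9:
  fixes b :: square and q :: nat and C R :: real
  assumes "CARD('a::{field, finite}) = q" and "C > 0"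
  shows "\<exists>c::real. c > 0 \<and> (\<exists>n0::nat. \<forall>n\<ge>n0. \<forall>m::nat. m > 0 \<and> real m = C * real n + R \<longrightarrow>
    real (num_orbits TYPE('a) b n m)
      \<le> real q ^ (m\<^sup>2) / real (order (GL TYPE('a) m))
        * (1 + real q powr (- c * (real n)\<^sup>2))
        * (real (card (Gr b n m :: (nat \<times> nat \<Rightarrow> 'a) set set)) / real (order (PGL TYPE('a) n))))"
proof -
  \<comment> \<open>The leading coefficients must become negative: C^2 + 1 + c - t / 8 for many
    pairs (the 8 comes from N >= n^2 / 8), 1 + c - C k for generic P, and c - C for nearly scalar P.
    With c <= 1 the margins 3 in \<open>t\<close> and \<open>k\<close> suffice.\<close>
  define c where "c = min 1 (C / 2)"
  define k where "k = nat \<lceil>3 / C\<rceil>"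
  define t where "t = nat \<lceil>8 * (C\<^sup>2 + 3)\<rceil>"
  have c: "0 < c" "c \<le> 1" "c \<le> C / 2" using assms(2) by (auto simp: c_def)
  have "3 / C \<le> real k" by (simp add: k_def real_nat_ceiling_ge)
  then have Ck: "3 \<le> C * real k" using assms(2) by (simp add: pos_divide_le_eq mult.commute)
  have t8: "C\<^sup>2 + 3 \<le> real t / 8" using real_nat_ceiling_ge[of "8 * (C\<^sup>2 + 3)"] by (simp add: t_def)
  let ?\<tau> = "2 * real t" and ?\<kappa> = "real k"
  have "\<forall>\<^sub>F n in sequentially. 2 \<le> n" by (rule eventually_ge_at_top)
  moreover have "\<forall>\<^sub>F n in sequentially. 2 * k \<le> n" by (rule eventually_ge_at_top)
  \<comment> \<open>This fact gives 2 t <= m and the next one m <= N. The others are the exponent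
    comparisons for m = C n + R with all terms on one side; N cancels except in the first of them,
    where it is replaced by its lower bound n^2 / 8.\<close>
  moreover have "\<forall>\<^sub>F n in sequentially. nat \<lceil>(?\<tau> - R) / C\<rceil> \<le> n" by (rule eventually_ge_at_top)
  moreover have "\<forall>\<^sub>F n in sequentially. (- 1 / 8) * (real n)\<^sup>2 + C * real n + R \<le> 0"
    by (rule eventually_quadratic_nonpos) simp
  moreover have "\<forall>\<^sub>F n in sequentially. (1 + C\<^sup>2 + c - real t / 8) * (real n)\<^sup>2 + 2 * C * R * real n + (R\<^sup>2 + 2) \<le> 0"
    by (rule eventually_quadratic_nonpos) (use t8 c in linarith)
  moreover have "\<forall>\<^sub>F n in sequentially. (1 + c - C * ?\<kappa>) * (real n)\<^sup>2
      + (C + C * (2 * ?\<kappa>\<^sup>2 + ?\<tau>) - (R - ?\<tau>) * ?\<kappa>) * real n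
      + (3 + R + (R - ?\<tau>) * (2 * ?\<kappa>\<^sup>2 + ?\<tau>)) \<le> 0"
    by (rule eventually_quadratic_nonpos) (use Ck c in linarith)
  moreover have "\<forall>\<^sub>F n in sequentially. (- 1) * (real n)\<^sup>2 + 4 * ?\<kappa> * real n + 1 \<le> 0"
    by (rule eventually_quadratic_nonpos) simp
  moreover have "\<forall>\<^sub>F n in sequentially. (c - C) * (real n)\<^sup>2
      + (4 * ?\<kappa> + C + C * (2 + ?\<tau>) - (R - ?\<tau>)) * real n
      + (4 + R + (R - ?\<tau>) * (2 + ?\<tau>)) \<le> 0"
    by (rule eventually_quadratic_nonpos) (use assms(2) c in linarith)
  ultimately have "\<forall>\<^sub>F n in sequentially. \<forall>m. m > 0 \<and> real m = C * real n + R \<longrightarrow>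
    real (num_orbits TYPE('a) b n m)
      \<le> real q ^ (m\<^sup>2) / real (order (GL TYPE('a) m))
        * (1 + real q powr (- c * (real n)\<^sup>2))
        * (real (card (Gr b n m :: (nat \<times> nat \<Rightarrow> 'a) set set)) / real (order (PGL TYPE('a) n)))"
  proof eventually_elim
    case (elim n)
    show ?case
    proof (intro allI impI, elim conjE)
      fix m :: nat assume m: "real m = C * real n + R"
      let ?N = "real (card (sq_index b n))"
      have N: "(real n)\<^sup>2 / 8 \<le> ?N" by (rule card_sq_index_ge) (rule elim(1))
      have "(?\<tau> - R) / C \<le> real n" using elim(3) by linarith
      then have "?\<tau> \<le> real m" using assms(2) m by (simp add: pos_divide_le_eq mult.commute)
      then have t: "2 * t \<le> m" by linarith
      have "real m \<le> ?N" using N elim(4) m by linarith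
      then have mN: "m \<le> card (sq_index b n)" by simp
      have "real t * ((real n)\<^sup>2 / 8) \<le> real t * ?N" using N by (rule mult_left_mono) simp
      then have 1: "(real n)\<^sup>2 + ?N * (real m - real t) \<le> real m * (?N - real m) - c * (real n)\<^sup>2 - 2"
        using elim(5) unfolding m by (simp add: power2_eq_square algebra_simps)
      have 2: "(real n)\<^sup>2 + (1 + real m * (?N - real m) + real m
          - (real m - ?\<tau>) * (?\<kappa> * (real n - 2 * ?\<kappa>) - ?\<tau>))
        \<le> real m * (?N - real m) - c * (real n)\<^sup>2 - 2"
        using elim(6) unfolding m by (simp add: power2_eq_square algebra_simps)
      have 3: "1 + 4 * ?\<kappa> * real n \<le> (real n)\<^sup>2" using elim(7) by simp
      have 4: "1 + 4 * ?\<kappa> * real n + (1 + real m * (?N - real m) + real m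
          - (real m - ?\<tau>) * (real n - 2 - ?\<tau>))
        \<le> real m * (?N - real m) - c * (real n)\<^sup>2 - 2"
        using elim(8) unfolding m by (simp add: power2_eq_square algebra_simps)
      let ?\<epsilon> = "real q powr (- c * (real n)\<^sup>2)"
      let ?A = "(1 + ?\<epsilon>) * (real (card (Gr b n m :: (nat \<times> nat \<Rightarrow> 'a) set set)) / real (order (PGL TYPE('a) n)))"
      have "real (num_orbits TYPE('a) b n m) \<le> ?A"
        using sum_fixed_Gr_le[where 'a = 'a, OF elim(1,2) t mN 1 2 3 4] elim(1) assms(1)
        by (intro num_orbits_le) auto
      moreover have "1 \<le> real q ^ (m\<^sup>2) / real (order (GL TYPE('a) m))"
      proof -
        have "real (order (GL TYPE('a) m)) \<le> real q ^ (m\<^sup>2)"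
          unfolding of_nat_power[symmetric] assms(1)[symmetric] by (intro of_nat_mono order_GL_bounds(2))
        then show ?thesis using order_GL_bounds(1)[of m, where 'a = 'a] by simp
      qed
      then have "1 * ?A \<le> real q ^ (m\<^sup>2) / real (order (GL TYPE('a) m)) * ?A"
        by (rule mult_right_mono) simp
      ultimately show "real (num_orbits TYPE('a) b n m)
          \<le> real q ^ (m\<^sup>2) / real (order (GL TYPE('a) m)) * (1 + ?\<epsilon>)
            * (real (card (Gr b n m :: (nat \<times> nat \<Rightarrow> 'a) set set)) / real (order (PGL TYPE('a) n)))"
        by (simp only: mult_1 mult.assoc)
    qed
  qed
  then show ?thesis using c(1) unfolding eventually_sequentially by blast
qed

end
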